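(* Let $d\mu\equiv e^{-\beta d^p}d\lambda/Z$ be a probability measure on $\mathbb{R}^N$ with $p>2$ and $\beta\in(0,\infty)$. Suppose there are constants $\sigma\in[1,\infty)$, $K\in(0,\infty)$ and $\delta\in\big(0,\frac{p^2\beta^2}{4\sigma^2}\big)$ such that $|\nabla d|\ge\frac1\sigma$ and $$\frac{p\beta}{2}|\nabla d|^2+\frac{p\beta}{2}\,d\,\Delta d\le K+\delta d^p .$$ Then there are constants $C,D\in(0,\infty)$ such that for all $f\in\mathcal{L}$ $$\mu\big(f^2d^p\big)\le C\,\mu\big(\langle d\rangle^{2-p}|\nabla f|^2\big)+D\,\mu f^2 ,$$ where $\langle d\rangle\equiv(1+d^2)^{1/2}$.
   Context: Setting. $\lambda$ is Lebesgue measure on $\mathbb{R}^N$. $\nabla=(X_1,\dots,X_k)$ is a finite collection of smooth, possibly noncommuting, vector fields on $\mathbb{R}^N$, each with zero divergence with respect to $\lambda$; $\nabla f=(X_1f,\dots,X_kf)$, $|\nabla f|=(\sum_i (X_if)^2)^{1/2}$ and $\Delta=\sum_i X_i^2$. $\mathcal{L}$ denotes the class of continuous functions $f:\mathbb{R}^N\to\mathbb{R}$ whose distributional derivatives $X_if$ are all in $L^\infty_{loc}$. $d:\mathbb{R}^N\to[0,\infty)$ is the distance from a fixed point (the origin) in some metric; it is assumed that $d\in\mathcal{L}$, that $|\nabla d|\le1$ almost everywhere, and that the balls $\{d\le R\}$ are compact. The lower bound on $|\nabla d|$ is understood almost everywhere; the inequality involving $\Delta d$ is understood in the sense of distributions away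 from the origin (on $\{d>0\}$, after division by $d$). Notation: $\mu g=\int g\,d\mu$; right-hand sides may be $+\infty$. *)

theory Defs
  imports "HOL-Probability.Probability"
begin

definition partial_deriv :: "'n::finite \<Rightarrow> (real^'n \<Rightarrow> real) \<Rightarrow> real^'n \<Rightarrow> real" where
  "partial_deriv j f x = frechet_derivative f (at x) (axis j 1)"

primrec C_class :: "nat \<Rightarrow> (real^'n::finite \<Rightarrow> real) \<Rightarrow> bool" where
  "C_class 0 f \<longleftrightarrow> continuous_on UNIV f"
| "C_class (Suc m) f \<longleftrightarrow>
     (\<forall>x. f differentiable (at x)) \<and> (\<forall>j. C_class m (partial_deriv j f))"

definition C_infinity :: "(real^'n::finite \<Rightarrow> real) \<Rightarrow> bool" where
  "C_infinity f \<longleftrightarrow> (\<forall>m. C_class m f)"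

definition smooth_vector_field :: "(real^'n::finite \<Rightarrow> real^'n) \<Rightarrow> bool" where
  "smooth_vector_field V \<longleftrightarrow> (\<forall>j. C_infinity (\<lambda>x. V x $ j))"

definition divergence :: "(real^'n::finite \<Rightarrow> real^'n) \<Rightarrow> real^'n \<Rightarrow> real" where
  "divergence V x = (\<Sum>j\<in>UNIV. partial_deriv j (\<lambda>y. V y $ j) x)"

definition test_functions :: "(real^'n::finite) set \<Rightarrow> (real^'n \<Rightarrow> real) set" where
  "test_functions U =
     {\<phi>. C_infinity \<phi> \<and> compact (closure {x. \<phi> x \<noteq> 0}) \<and> closure {x. \<phi> x \<noteq> 0} \<subseteq> U}"

text \<open>
  Distributions are represented by their action on test functions, i.e. by functionals of type
  \<^typ>\<open>(real^'n \<Rightarrow> real) \<Rightarrow> real\<close>. Functionals are compared only on test functions.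
\<close>

definition regular_distr :: "(real^'n::finite \<Rightarrow> real) \<Rightarrow> (real^'n \<Rightarrow> real) \<Rightarrow> real" where
  "regular_distr u \<phi> = (\<integral>x. u x * \<phi> x \<partial>lborel)"

text \<open>
  The formal adjoint of \<open>V = \<Sum>j. V\<^sub>j \<partial>\<^sub>j\<close> with respect to Lebesgue measure is
  \<open>\<phi> \<mapsto> - div (\<phi> V)\<close>; this is \<open>- V \<phi>\<close> when \<open>V\<close> is divergence free.
\<close>

definition formal_adjoint ::
  "(real^'n::finite \<Rightarrow> real^'n) \<Rightarrow> (real^'n \<Rightarrow> real) \<Rightarrow> real^'n \<Rightarrow> real" where
  "formal_adjoint V \<phi> x = - divergence (\<lambda>y. \<phi> y *\<^sub>R V y) x"

definition distr_deriv ::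
  "(real^'n::finite \<Rightarrow> real^'n) \<Rightarrow> ((real^'n \<Rightarrow> real) \<Rightarrow> real) \<Rightarrow> (real^'n \<Rightarrow> real) \<Rightarrow> real" where
  "distr_deriv V T \<phi> = T (formal_adjoint V \<phi>)"

definition distr_eq_on ::
  "(real^'n::finite) set \<Rightarrow> ((real^'n \<Rightarrow> real) \<Rightarrow> real) \<Rightarrow> ((real^'n \<Rightarrow> real) \<Rightarrow> real) \<Rightarrow> bool" where
  "distr_eq_on U S T \<longleftrightarrow> (\<forall>\<phi>\<in>test_functions U. S \<phi> = T \<phi>)"

definition distr_le_on ::
  "(real^'n::finite) set \<Rightarrow> ((real^'n \<Rightarrow> real) \<Rightarrow> real) \<Rightarrow> ((real^'n \<Rightarrow> real) \<Rightarrow> real) \<Rightarrow> bool" where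
  "distr_le_on U S T \<longleftrightarrow> (\<forall>\<phi>\<in>test_functions U. (\<forall>x. 0 \<le> \<phi> x) \<longrightarrow> S \<phi> \<le> T \<phi>)"

definition Linfty_loc :: "(real^'n::finite \<Rightarrow> real) set" where
  "Linfty_loc = {g. g \<in> borel_measurable borel \<and>
     (\<forall>S. compact S \<longrightarrow> (\<exists>M. AE x in lborel. x \<in> S \<longrightarrow> \<bar>g x\<bar> \<le> M))}"

definition is_weak_deriv ::
  "(real^'n::finite \<Rightarrow> real^'n) \<Rightarrow> (real^'n \<Rightarrow> real) \<Rightarrow> (real^'n \<Rightarrow> real) \<Rightarrow> bool" where
  "is_weak_deriv V f g \<longleftrightarrow>
     g \<in> Linfty_loc \<and> distr_eq_on UNIV (distr_deriv V (regular_distr f)) (regular_distr g)"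

definition class_L :: "(nat \<Rightarrow> real^'n::finite \<Rightarrow> real^'n) \<Rightarrow> nat \<Rightarrow> (real^'n \<Rightarrow> real) set" where
  "class_L X k = {f. continuous_on UNIV f \<and> (\<forall>i\<in>{1..k}. \<exists>g. is_weak_deriv (X i) f g)}"

text \<open>
  For a member of \<^const>\<open>class_L\<close> the weak derivatives are unique almost everywhere, so the choice of
  representative does not affect integrals or almost everywhere statements.
\<close>

definition weak_deriv ::
  "(real^'n::finite \<Rightarrow> real^'n) \<Rightarrow> (real^'n \<Rightarrow> real) \<Rightarrow> real^'n \<Rightarrow> real" where
  "weak_deriv V f = (SOME g. is_weak_deriv V f g)"

definition grad_norm ::
  "(nat \<Rightarrow> real^'n::finite \<Rightarrow> real^'n) \<Rightarrow> nat \<Rightarrow> (real^'n \<Rightarrow> real) \<Rightarrow> real^'n \<Rightarrow> real" where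
  "grad_norm X k f x = sqrt (\<Sum>i=1..k. (weak_deriv (X i) f x)\<^sup>2)"

definition distr_laplacian ::
  "(nat \<Rightarrow> real^'n::finite \<Rightarrow> real^'n) \<Rightarrow> nat \<Rightarrow>
    ((real^'n \<Rightarrow> real) \<Rightarrow> real) \<Rightarrow> (real^'n \<Rightarrow> real) \<Rightarrow> real" where
  "distr_laplacian X k T \<phi> = (\<Sum>i=1..k. distr_deriv (X i) (distr_deriv (X i) T) \<phi>)"

definition bracket :: "real \<Rightarrow> real" where
  "bracket t = sqrt (1 + t\<^sup>2)"

end

theory Submission
  imports Defs "HOL-Computational_Algebra.Polynomial"
begin

text \<open>
  Expanding \<open>\<bar>\<nabla>f - (p\<beta>/2) d\<^sup>p\<^sup>-\<^sup>1 f \<nabla>d\<bar>\<^sup>2 \<ge> 0\<close> with the weight \<open>d\<^sup>2\<^sup>-\<^sup>p\<close> bounds \<open>\<mu> (d\<^sup>2\<^sup>-\<^sup>p \<bar>\<nabla>f\<bar>\<^sup>2)\<close> from below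
  by a cross term, in which the Laplacian hypothesis tested with \<open>f\<^sup>2 d exp (- \<beta> d\<^sup>p)\<close> produces
  \<open>(p\<^sup>2\<beta>\<^sup>2/(4\<sigma>\<^sup>2) - \<delta>) \<mu> (f\<^sup>2 d\<^sup>p) - K \<mu> f\<^sup>2\<close>. The weight is singular at the origin, so \<open>f\<close> is first cut off
  to a shell \<open>1/2 \<le> d \<le> T + 1\<close>, with constants uniform in \<open>T\<close>.

  The test function \<open>f\<^sup>2 G(d)\<close> is not smooth, so it is approximated by \<open>f\<^sub>N\<^sup>2 G(d\<^sub>N)\<close>, where \<open>f\<^sub>N\<close> and \<open>d\<^sub>N\<close> are
  mollifications. In the limit every term contains only one derivative of a mollification, paired with
  a fixed bounded function. Hence weak-star convergence of \<open>X\<^sub>i f\<^sub>N\<close> to the weak derivative suffices, and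
  this follows from convergence against test functions and the local boundedness of \<open>X\<^sub>i f\<^sub>N\<close>.
\<close>

subsection \<open>Calculus of smooth functions\<close>

text \<open>Why this test function: its factor \<open>d\<close> cancels the division by
  \<open>d\<close> in the hypothesis, and differentiating that factor produces exactly the term that
  cancels \<open>p * \<beta> / 2\<close> times the squared gradient of \<open>d\<close>.
  Differentiating the exponential then leaves p^2 beta^2 / 2 times f^2 d^p |grad d|^2. Completing
  the square spends half of this; the lower bound 1/sigma on the other half gives p^2 beta^2 / (4
  sigma^2), which is the origin of the threshold for \<open>\<delta>\<close>. The cutoff adds only a
  multiple of f^2, because its derivative is bounded independently of \<open>T\<close> and d^(2-p)
  is bounded on d >= 1/2. Where d < 1, the trivial bound d^p <= 1 replaces the lost estimate and
  contributes the summand 1 to the constant \<open>D\<close>. Since the right-hand side may be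
  infinite, signed integrals occur only for compactly supported integrands; the unbounded terms are
  handled by nonnegative integrals, and \<open>T\<close> tends to infinity only at the end.\<close>

lemma partial_deriv_eq:
  "(f has_derivative f') (at x) \<Longrightarrow> partial_deriv j f x = f' (axis j 1)"
  unfolding partial_deriv_def using frechet_derivative_at by metis

lemma has_derivative_partial_deriv:
  fixes f :: "real^'n::finite \<Rightarrow> real"
  assumes "f differentiable (at x)"
  shows "(f has_derivative (\<lambda>h. \<Sum>j\<in>UNIV. h $ j * partial_deriv j f x)) (at x)"
proof -
  let ?D = "frechet_derivative f (at x)"
  have D: "(f has_derivative ?D) (at x)"
    using assms frechet_derivative_works by blast
  then interpret linear ?D
    by (rule has_derivative_linear)
  have "?D h = (\<Sum>j\<in>UNIV. h $ j * partial_deriv j f x)" for h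
  proof -
    have "?D h = ?D (\<Sum>j\<in>UNIV. (h $ j) *\<^sub>R axis j 1)"
      using basis_expansion[of h] by (simp add: scalar_mult_eq_scaleR)
    also have "\<dots> = (\<Sum>j\<in>UNIV. h $ j * partial_deriv j f x)"
      by (simp add: sum scaleR partial_deriv_def)
    finally show ?thesis .
  qed
  then have "?D = (\<lambda>h. \<Sum>j\<in>UNIV. h $ j * partial_deriv j f x)" by auto
  with D show ?thesis by simp
qed

lemma partial_deriv_const [simp]: "partial_deriv j (\<lambda>x. c) = (\<lambda>x. 0)"
  by (simp add: partial_deriv_def fun_eq_iff)

lemma partial_deriv_add:
  assumes "f differentiable (at x)" "g differentiable (at x)"
  shows "partial_deriv j (\<lambda>x. f x + g x) x = partial_deriv j f x + partial_deriv j g x"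
  by (subst partial_deriv_eq[OF has_derivative_add[OF
        assms[unfolded frechet_derivative_works]]]) (simp add: partial_deriv_def)

lemma partial_deriv_mult:
  fixes f g :: "real^'n::finite \<Rightarrow> real"
  assumes "f differentiable (at x)" "g differentiable (at x)"
  shows "partial_deriv j (\<lambda>x. f x * g x) x = f x * partial_deriv j g x + partial_deriv j f x * g x"
  by (subst partial_deriv_eq[OF has_derivative_mult[OF
        assms[unfolded frechet_derivative_works]]]) (simp add: partial_deriv_def)

lemma partial_deriv_compose:
  fixes g :: "real^'n::finite \<Rightarrow> real"
  assumes "g differentiable (at x)" "(h has_field_derivative h') (at (g x))"
  shows "((\<lambda>x. h (g x)) has_derivative (\<lambda>v. h' * frechet_derivative g (at x) v)) (at x)"
    and "partial_deriv j (\<lambda>x. h (g x)) x = h' * partial_deriv j g x"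
proof -
  show *: "((\<lambda>x. h (g x)) has_derivative (\<lambda>v. h' * frechet_derivative g (at x) v)) (at x)"
    using has_derivative_compose[OF assms(1)[unfolded frechet_derivative_works]
        assms(2)[unfolded has_field_derivative_def]] by simp
  show "partial_deriv j (\<lambda>x. h (g x)) x = h' * partial_deriv j g x"
    by (subst partial_deriv_eq[OF *]) (simp add: partial_deriv_def)
qed

lemma partial_deriv_affine:
  fixes f :: "real^'n::finite \<Rightarrow> real"
  assumes "f differentiable (at (a + c *\<^sub>R x))"
  shows "((\<lambda>x. f (a + c *\<^sub>R x)) has_derivative
      (\<lambda>v. frechet_derivative f (at (a + c *\<^sub>R x)) (c *\<^sub>R v))) (at x)"
    and "partial_deriv j (\<lambda>x. f (a + c *\<^sub>R x)) x = c * partial_deriv j f (a + c *\<^sub>R x)"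
proof -
  have D: "(f has_derivative frechet_derivative f (at (a + c *\<^sub>R x))) (at (a + c *\<^sub>R x))"
    using assms frechet_derivative_works by blast
  have "((\<lambda>x. a + c *\<^sub>R x) has_derivative (\<lambda>v. c *\<^sub>R v)) (at x)"
    by (auto intro!: derivative_eq_intros)
  from has_derivative_compose[OF this D]
  show *: "((\<lambda>x. f (a + c *\<^sub>R x)) has_derivative
      (\<lambda>v. frechet_derivative f (at (a + c *\<^sub>R x)) (c *\<^sub>R v))) (at x)" .
  show "partial_deriv j (\<lambda>x. f (a + c *\<^sub>R x)) x = c * partial_deriv j f (a + c *\<^sub>R x)"
    using linear_cmul[OF has_derivative_linear[OF D], of c "axis j 1"]
    by (subst partial_deriv_eq[OF *]) (simp add: partial_deriv_def)
qed

lemma C_class_SucD: "C_class (Suc m) f \<Longrightarrow> C_class m f"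
proof (induction m arbitrary: f)
  case 0
  then show ?case
    by (auto simp: continuous_on_eq_continuous_at intro: differentiable_imp_continuous_within)
next
  case (Suc m)
  then show ?case
    by (metis C_class.simps(2))
qed

lemma C_class_continuous: "C_class m f \<Longrightarrow> continuous_on UNIV f"
  by (induction m) (use C_class_SucD C_class.simps in blast)+

lemma C_class_const: "C_class m (\<lambda>x. c)"
  by (induction m arbitrary: c) (auto simp: C_class.simps)

lemma C_class_add: "C_class m f \<Longrightarrow> C_class m g \<Longrightarrow> C_class m (\<lambda>x. f x + g x)"
proof (induction m arbitrary: f g)
  case 0
  then show ?case by (auto intro: continuous_on_add)
next
  case (Suc m)
  then have "partial_deriv j (\<lambda>x. f x + g x) = (\<lambda>x. partial_deriv j f x + partial_deriv j g x)" for j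
    by (auto simp: fun_eq_iff partial_deriv_add)
  with Suc show ?case by (auto simp: differentiable_add)
qed

lemma C_class_mult: "C_class m f \<Longrightarrow> C_class m g \<Longrightarrow> C_class m (\<lambda>x. f x * g x)"
proof (induction m arbitrary: f g)
  case 0
  then show ?case by (auto intro: continuous_on_mult)
next
  case (Suc m)
  then have "partial_deriv j (\<lambda>x. f x * g x)
      = (\<lambda>x. f x * partial_deriv j g x + partial_deriv j f x * g x)" for j
    by (auto simp: fun_eq_iff partial_deriv_mult)
  moreover have "C_class m f" "C_class m g"
    using Suc.prems C_class_SucD by blast+
  ultimately show ?case using Suc by (auto simp: differentiable_mult intro!: C_class_add)
qed

text \<open>The whole sequence \<open>H\<close> of successive derivatives is carried along: the
  chain rule turns \<open>H n\<close> into \<open>H (Suc n)\<close>, so the induction on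
  \<open>m\<close> must range over all \<open>n\<close>. The set \<open>S\<close> allows functions
  such as powers that are smooth only on part of the line.\<close>

lemma C_class_compose:
  assumes "\<And>n t. t \<in> S \<Longrightarrow> (H n has_field_derivative H (Suc n) t) (at t)"
    and "\<And>x. g x \<in> S"
  shows "C_class m g \<Longrightarrow> C_class m (\<lambda>x. H n (g x))"
proof (induction m arbitrary: n)
  case 0
  have "isCont (H n) (g x)" for x
    using assms DERIV_isCont by blast
  with 0 show ?case
    by (auto simp: continuous_on_eq_continuous_at intro: continuous_within_compose3)
next
  case (Suc m)
  have diff: "g differentiable (at x)" for x using Suc by auto
  have "partial_deriv j (\<lambda>x. H n (g x)) = (\<lambda>x. H (Suc n) (g x) * partial_deriv j g x)" for j
    using partial_deriv_compose(2)[OF diff assms(1)[OF assms(2)]] by auto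
  moreover have "(\<lambda>x. H n (g x)) differentiable (at x)" for x
    using partial_deriv_compose(1)[OF diff assms(1)[OF assms(2)]] differentiableI by blast
  moreover have "C_class m g" using Suc.prems C_class_SucD by blast
  ultimately show ?case using Suc by (auto intro!: C_class_mult)
qed

lemma C_class_affine: "C_class m f \<Longrightarrow> C_class m (\<lambda>x. f (a + c *\<^sub>R x))"
proof (induction m arbitrary: f)
  case 0
  then show ?case by (auto intro!: continuous_intros elim: continuous_on_compose2)
next
  case (Suc m)
  have diff: "f differentiable (at x)" for x using Suc by auto
  have "partial_deriv j (\<lambda>x. f (a + c *\<^sub>R x)) = (\<lambda>x. c * partial_deriv j f (a + c *\<^sub>R x))" for j
    using partial_deriv_affine(2)[OF diff] by auto
  moreover have "(\<lambda>x. f (a + c *\<^sub>R x)) differentiable (at x)" for x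
    using partial_deriv_affine(1)[OF diff] differentiableI by blast
  ultimately show ?case using Suc by (auto intro!: C_class_mult C_class_const)
qed

lemma C_infinity_differentiable: "C_infinity f \<Longrightarrow> f differentiable (at x)"
  unfolding C_infinity_def by (metis C_class.simps(2))

lemma C_infinity_partial_deriv: "C_infinity f \<Longrightarrow> C_infinity (partial_deriv j f)"
  unfolding C_infinity_def by (metis C_class.simps(2))

lemma C_infinity_continuous: "C_infinity f \<Longrightarrow> continuous_on UNIV f"
  unfolding C_infinity_def using C_class_continuous by blast

lemma C_infinity_measurable: "C_infinity f \<Longrightarrow> f \<in> borel_measurable borel"
  by (simp add: C_infinity_continuous borel_measurable_continuous_onI)

lemma C_infinity_const: "C_infinity (\<lambda>x. c)"
  by (simp add: C_infinity_def C_class_const)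

lemma C_infinity_add: "C_infinity f \<Longrightarrow> C_infinity g \<Longrightarrow> C_infinity (\<lambda>x. f x + g x)"
  by (simp add: C_infinity_def C_class_add)

lemma C_infinity_mult: "C_infinity f \<Longrightarrow> C_infinity g \<Longrightarrow> C_infinity (\<lambda>x. f x * g x)"
  by (simp add: C_infinity_def C_class_mult)

lemma C_infinity_uminus: "C_infinity f \<Longrightarrow> C_infinity (\<lambda>x. - f x)"
  using C_infinity_mult[OF C_infinity_const[of "-1"]] by simp

lemma C_infinity_diff: "C_infinity f \<Longrightarrow> C_infinity g \<Longrightarrow> C_infinity (\<lambda>x. f x - g x)"
  using C_infinity_add[OF _ C_infinity_uminus, of f g] by simp

lemma C_infinity_sum:
  "(\<And>i. i \<in> I \<Longrightarrow> C_infinity (f i)) \<Longrightarrow> C_infinity (\<lambda>x. \<Sum>i\<in>I. f i x)"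
  by (induction I rule: infinite_finite_induct) (auto simp: C_infinity_const C_infinity_add)

lemma C_infinity_compose:
  assumes "\<And>n t. t \<in> S \<Longrightarrow> (H n has_field_derivative H (Suc n) t) (at t)"
    and "\<And>x. g x \<in> S" and "C_infinity g"
  shows "C_infinity (\<lambda>x. H 0 (g x))"
  using assms(3) C_class_compose[of S H g, OF assms(1,2)] by (simp add: C_infinity_def)

lemma C_infinity_affine: "C_infinity f \<Longrightarrow> C_infinity (\<lambda>x. f (a + c *\<^sub>R x))"
  by (simp add: C_infinity_def C_class_affine)

lemma C_infinity_component: "C_infinity (\<lambda>x::real^'n::finite. x $ i)"
proof -
  have D: "((\<lambda>x::real^'n. x $ i) has_derivative (\<lambda>h. h $ i)) (at x)" for x
    by (rule bounded_linear_imp_has_derivative[OF bounded_linear_vec_nth])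
  have p: "partial_deriv j (\<lambda>x::real^'n. x $ i) = (\<lambda>x. axis j 1 $ i)" for j
    using partial_deriv_eq[OF D] by auto
  have "C_class m (\<lambda>x::real^'n. x $ i)" for m
  proof (cases m)
    case 0
    then show ?thesis by (simp add: continuous_on_component)
  next
    case (Suc m')
    then show ?thesis using D differentiableI
      by (simp add: p C_class_const) blast
  qed
  then show ?thesis by (simp add: C_infinity_def)
qed

section \<open>A flat function on the real line and smooth compositions\<close>

definition flat_exp :: "real poly \<Rightarrow> real \<Rightarrow> real" where
  "flat_exp q t = (if 0 < t then poly q (1 / t) * exp (- (1 / t)) else 0)"

lemma poly_times_exp_tendsto_0: "((\<lambda>s::real. poly q s * exp (- s)) \<longlongrightarrow> 0) at_top"
proof -
  have "((\<lambda>s. \<Sum>i\<le>degree q. coeff q i * (s ^ i / exp s)) \<longlongrightarrow> (\<Sum>i\<le>degree q. coeff q i * 0)) at_top"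
    by (intro tendsto_intros tendsto_power_div_exp_0)
  then show ?thesis
    by (simp add: poly_altdef sum_divide_distrib exp_minus field_simps)
qed

text \<open>With s = 1/t, differentiating q(s) e^(-s) in t gives s^2 (q - q')(s) e^(-s). The family
  is therefore closed under differentiation, which reduces smoothness to this single
  formula.\<close>

lemma flat_exp_has_derivative:
  "(flat_exp q has_field_derivative flat_exp (monom 1 2 * (q - pderiv q)) t) (at t)"
proof -
  consider "t > 0" | "t < 0" | "t = 0" by linarith
  then show ?thesis
  proof cases
    case 1
    have "((\<lambda>t. poly q (1 / t) * exp (- (1 / t))) has_field_derivative
        (poly q (1 / t) - poly (pderiv q) (1 / t)) * exp (- (1 / t)) / t\<^sup>2) (at t)"
      using 1 by (auto intro!: derivative_eq_intros DERIV_chain2[OF poly_DERIV]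
          simp: field_simps power2_eq_square)
    then have "(flat_exp q has_field_derivative
        (poly q (1 / t) - poly (pderiv q) (1 / t)) * exp (- (1 / t)) / t\<^sup>2) (at t)"
      by (rule DERIV_cong_ev[THEN iffD1, rotated 3])
        (use 1 eventually_nhds_in_open[of "{0<..}" t] in
          \<open>auto simp: flat_exp_def elim!: eventually_mono\<close>)
    then show ?thesis using 1 by (simp add: flat_exp_def poly_monom power_divide)
  next
    case 2
    have "((\<lambda>t. 0) has_field_derivative 0) (at t)" by simp
    then have "(flat_exp q has_field_derivative 0) (at t)"
      by (rule DERIV_cong_ev[THEN iffD1, rotated 3])
        (use 2 eventually_nhds_in_open[of "{..<0}" t] in
          \<open>auto simp: flat_exp_def elim!: eventually_mono\<close>)
    then show ?thesis using 2 by (simp add: flat_exp_def)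
  next
    case 3
    \<comment> \<open>The right difference quotient at 0 is s q(s) e^(-s) with s = 1/h, and
      \<open>pCons 0 q\<close> is the polynomial s q(s).\<close>
    have "((\<lambda>h. poly (pCons 0 q) (inverse h) * exp (- inverse h)) \<longlongrightarrow> 0) (at_right 0)"
      by (rule filterlim_compose[OF poly_times_exp_tendsto_0 filterlim_inverse_at_top_right])
    then have "((\<lambda>h. flat_exp q h / h) \<longlongrightarrow> 0) (at_right 0)"
      by (rule Lim_transform_eventually)
        (auto simp: eventually_at_right_field flat_exp_def field_simps intro!: exI[of _ 1])
    moreover have "((\<lambda>h. flat_exp q h / h) \<longlongrightarrow> 0) (at_left 0)"
      by (rule Lim_transform_eventually[OF tendsto_const])
        (auto simp: eventually_at_left_field flat_exp_def intro!: exI[of _ "-1"])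
    ultimately have "((\<lambda>h. flat_exp q h / h) \<longlongrightarrow> 0) (at 0)"
      by (simp add: filterlim_split_at)
    then show ?thesis using 3 by (simp add: DERIV_def flat_exp_def)
  qed
qed

lemma C_infinity_flat_exp:
  assumes "C_infinity g"
  shows "C_infinity (\<lambda>x. flat_exp q (g x))"
proof -
  let ?Q = "\<lambda>n. ((\<lambda>q. monom 1 2 * (q - pderiv q)) ^^ n) q"
  have "C_infinity (\<lambda>x. flat_exp (?Q 0) (g x))"
    by (rule C_infinity_compose[where S = UNIV and H = "\<lambda>n. flat_exp (?Q n)"])
      (auto simp: assms flat_exp_has_derivative)
  then show ?thesis by simp
qed

lemma C_infinity_exp:
  assumes "C_infinity g"
  shows "C_infinity (\<lambda>x. exp (g x))"
  using C_infinity_compose[where S = UNIV and H = "\<lambda>_. exp", OF _ _ assms] by simp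

text \<open>The falling factorials supply all derivatives of t^a in closed form; positivity of
  \<open>g\<close> keeps its values in the region where these formulas hold.\<close>

lemma C_infinity_powr:
  assumes "C_infinity g" and "\<And>x. g x > 0"
  shows "C_infinity (\<lambda>x. g x powr a)"
proof -
  have "C_infinity (\<lambda>x. (\<Prod>i<(0::nat). a - real i) * g x powr (a - real 0))"
  proof (rule C_infinity_compose[where S = "{0<..}" and
        H = "\<lambda>n t. (\<Prod>i<n. a - real i) * t powr (a - real n)"])
    show "((\<lambda>t. (\<Prod>i<n. a - real i) * t powr (a - real n)) has_field_derivative
        (\<Prod>i<Suc n. a - real i) * t powr (a - real (Suc n))) (at t)" if "t \<in> {0<..}" for n t
      using that by (auto intro!: derivative_eq_intros simp: algebra_simps)
  qed (use assms in auto)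
  then show ?thesis by simp
qed

subsection \<open>Mollification\<close>

lemma integrable_bounded_support:
  fixes f :: "'a::euclidean_space \<Rightarrow> real"
  assumes "f \<in> borel_measurable borel" "AE x in lborel. \<bar>f x\<bar> \<le> M * indicator (cball a r) x"
  shows "integrable lborel f"
proof (rule Bochner_Integration.integrable_bound)
  show "integrable lborel (\<lambda>x. M * indicator (cball a r) x)"
    using emeasure_lborel_cball_finite[of a r]
    by (intro integrable_mult_right integrable_real_indicator) auto
qed (use assms in \<open>auto elim!: eventually_mono\<close>)

lemma continuous_bounded_on_cball:
  fixes f :: "'a::euclidean_space \<Rightarrow> real"
  assumes "continuous_on UNIV f"
  shows "\<exists>M\<ge>0. \<forall>x\<in>cball a r. \<bar>f x\<bar> \<le> M"
proof -
  have "compact (f ` cball a r)"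
    by (intro compact_continuous_image continuous_on_subset[OF assms]) auto
  then have "bounded (f ` cball a r)" by (rule compact_imp_bounded)
  then obtain M where "M > 0" "\<forall>x\<in>cball a r. \<bar>f x\<bar> \<le> M"
    by (auto simp: bounded_pos)
  then show ?thesis by (intro exI[of _ M]) auto
qed

lemma integrable_continuous_support:
  fixes f :: "'a::euclidean_space \<Rightarrow> real"
  assumes "continuous_on UNIV f" "\<And>x. x \<notin> cball a r \<Longrightarrow> f x = 0"
  shows "integrable lborel f"
proof -
  obtain M where "\<forall>x\<in>cball a r. \<bar>f x\<bar> \<le> M"
    using continuous_bounded_on_cball[OF assms(1), of a r] by auto
  then show ?thesis
    using assms by (intro integrable_bounded_support[where M = M and a = a and r = r])
      (auto intro!: borel_measurable_continuous_onI split: split_indicator)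
qed

section \<open>Convolution with a smooth compactly supported kernel\<close>

definition conv :: "(real^'n::finite \<Rightarrow> real) \<Rightarrow> (real^'n \<Rightarrow> real) \<Rightarrow> real^'n \<Rightarrow> real" where
  "conv f \<psi> x = (\<integral>y. f y * \<psi> (x - y) \<partial>lborel)"

lemma conv_integrable:
  fixes f \<psi> :: "real^'n::finite \<Rightarrow> real"
  assumes "continuous_on UNIV f" "continuous_on UNIV \<psi>" "\<And>z. norm z > r \<Longrightarrow> \<psi> z = 0"
  shows "integrable lborel (\<lambda>y. f y * \<psi> (x - y))"
proof (rule integrable_continuous_support[of _ x r])
  show "continuous_on UNIV (\<lambda>y. f y * \<psi> (x - y))"
    by (intro continuous_on_mult assms(1) continuous_on_compose2[OF assms(2)] continuous_intros) auto
  show "f y * \<psi> (x - y) = 0" if "y \<notin> cball x r" for y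
    using that assms(3)[of "x - y"] by (auto simp: dist_norm)
qed

lemma partial_deriv_support:
  fixes \<psi> :: "real^'n::finite \<Rightarrow> real"
  assumes "\<And>z. norm z > r \<Longrightarrow> \<psi> z = 0" "norm z > r"
  shows "partial_deriv j \<psi> z = 0"
proof -
  have "(\<psi> has_derivative (\<lambda>_. 0)) (at z)"
  proof (rule has_derivative_transform_within_open[where f = "\<lambda>_. 0" and s = "- cball 0 r"])
    show "z \<in> - cball 0 r" using assms by simp
  qed (use assms in auto)
  from partial_deriv_eq[OF this] show ?thesis by simp
qed

text \<open>Differentiation under the integral puts the derivative on the kernel, so continuity of
  \<open>f\<close> is enough. The Leibniz rule is available over a compact box, hence the integral
  is first localised for \<open>x\<close> near \<open>x0\<close>.\<close>

lemma conv_has_derivative: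
  fixes f \<psi> :: "real^'n::finite \<Rightarrow> real"
  assumes f: "continuous_on UNIV f" and \<psi>: "C_class (Suc 0) \<psi>"
    and supp: "\<And>z. norm z > r \<Longrightarrow> \<psi> z = 0"
  shows "(conv f \<psi> has_derivative (\<lambda>h. \<Sum>j\<in>UNIV. h $ j * conv f (partial_deriv j \<psi>) x0)) (at x0)"
proof -
  have diff: "\<psi> differentiable (at x)" for x using \<psi> by simp
  have cont_pd: "continuous_on UNIV (partial_deriv j \<psi>)" for j using \<psi> by simp
  have cont_\<psi>: "continuous_on UNIV \<psi>" using C_class_continuous[OF \<psi>] .
  \<comment> \<open>For every \<open>x\<close> within distance 1 of \<open>x0\<close>, the kernel
    centred at \<open>x\<close> is supported in the ball of radius \<open>r + 1\<close> about
    \<open>x0\<close>, so one box serves all of them.\<close>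
  obtain a where a: "cball x0 (r + 1) \<subseteq> cbox (- a) a"
    using bounded_subset_cbox_symmetric[OF bounded_cball] by metis
  let ?B = "cbox (- a) a"
  define U where "U = ball x0 1"
  have conv_eq: "conv f \<phi> x = integral ?B (\<lambda>y. f y * \<phi> (x - y))"
    if x: "x \<in> U" and \<phi>: "continuous_on UNIV \<phi>" "\<And>z. norm z > r \<Longrightarrow> \<phi> z = 0" for x \<phi>
  proof -
    have "f y * \<phi> (x - y) = 0" if "y \<notin> ?B" for y
    proof -
      have "y \<notin> cball x0 (r + 1)" using a that by blast
      then have "dist x0 y > r + 1" by simp
      with x have "norm (x - y) > r"
        using dist_triangle[of x0 y x] by (auto simp: U_def dist_norm norm_minus_commute)
      then show ?thesis using \<phi>(2) by simp
    qed
    then have "integral UNIV (\<lambda>y. if y \<in> ?B then f y * \<phi> (x - y) else 0)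
        = integral UNIV (\<lambda>y. f y * \<phi> (x - y))"
      by (intro arg_cong[where f = "integral UNIV"]) auto
    also have "\<dots> = conv f \<phi> x"
      unfolding conv_def by (rule integral_lborel[OF conv_integrable[OF f \<phi>]])
    finally show ?thesis
      by (simp add: Henstock_Kurzweil_Integration.integral_restrict_UNIV)
  qed
  define v where "v z = (\<chi> j. partial_deriv j \<psi> z)" for z
  have cont_v: "continuous_on UNIV v"
    unfolding v_def by (intro continuous_on_vec_lambda cont_pd)
  \<comment> \<open>The derivative is packaged as a bounded linear functional, since the Leibniz
    rule requires its joint continuity in \<open>x\<close> and \<open>t\<close> in operator
    norm.\<close>
  define fx where "fx x t = blinfun_inner_right (f t *\<^sub>R v (x - t))" for x t
  have D: "((\<lambda>x. integral ?B (\<lambda>y. f y * \<psi> (x - y))) has_derivative integral ?B (fx x0)) (at x0 within U)"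
  proof (rule leibniz_rule)
    fix x t
    have "((\<lambda>x. x - t) has_derivative (\<lambda>h. h)) (at x within U)"
      by (auto intro!: derivative_eq_intros)
    from has_derivative_compose[OF this has_derivative_partial_deriv[OF diff]]
    have "((\<lambda>x. \<psi> (x - t)) has_derivative (\<lambda>h. \<Sum>j\<in>UNIV. h $ j * partial_deriv j \<psi> (x - t))) (at x within U)" .
    note D\<psi> = this
    have "blinfun_apply (fx x t) = (\<lambda>h. f t * (\<Sum>j\<in>UNIV. h $ j * partial_deriv j \<psi> (x - t)))"
      unfolding fx_def v_def blinfun_inner_right.rep_eq
      by (rule ext) (simp add: inner_vec_def sum_distrib_left mult_ac)
    then show "((\<lambda>x. f t * \<psi> (x - t)) has_derivative blinfun_apply (fx x t)) (at x within U)"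
      using has_derivative_mult_right[OF D\<psi>, of "f t"] by (simp only:)
  next
    fix x
    show "(\<lambda>y. f y * \<psi> (x - y)) integrable_on ?B"
      by (intro integrable_continuous continuous_on_mult continuous_on_subset[OF f]
          continuous_on_compose2[OF cont_\<psi>] continuous_intros) auto
  next
    show "continuous_on (U \<times> ?B) (\<lambda>(x, t). fx x t)"
      unfolding fx_def case_prod_beta
      by (intro bounded_linear.continuous_on[OF bounded_linear_blinfun_inner_right] continuous_on_scaleR
          continuous_on_compose2[OF f] continuous_on_compose2[OF cont_v] continuous_intros) auto
  qed (auto simp: U_def)
  have "blinfun_apply (integral ?B (fx x0)) h = (\<Sum>j\<in>UNIV. h $ j * conv f (partial_deriv j \<psi>) x0)" for h
  proof -
    have "fx x0 integrable_on ?B"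
      unfolding fx_def
      by (intro integrable_continuous bounded_linear.continuous_on[OF bounded_linear_blinfun_inner_right]
          continuous_on_scaleR continuous_on_subset[OF f] continuous_on_compose2[OF cont_v]
          continuous_intros) auto
    then have "blinfun_apply (integral ?B (fx x0)) h = integral ?B (\<lambda>t. blinfun_apply (fx x0 t) h)"
      by (rule blinfun_apply_integral)
    also have "\<dots> = integral ?B (\<lambda>t. \<Sum>j\<in>UNIV. h $ j * (f t * partial_deriv j \<psi> (x0 - t)))"
      by (simp add: fx_def v_def inner_vec_def mult_ac)
    also have "\<dots> = (\<Sum>j\<in>UNIV. integral ?B (\<lambda>t. h $ j * (f t * partial_deriv j \<psi> (x0 - t))))"
      by (intro Henstock_Kurzweil_Integration.integral_sum integrable_continuous continuous_on_mult
          continuous_on_subset[OF f] continuous_on_compose2[OF cont_pd] continuous_intros) auto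
    also have "\<dots> = (\<Sum>j\<in>UNIV. h $ j * conv f (partial_deriv j \<psi>) x0)"
      using conv_eq[OF _ cont_pd partial_deriv_support[OF supp], of x0] by (simp add: U_def)
    finally show ?thesis .
  qed
  then have "blinfun_apply (integral ?B (fx x0)) = (\<lambda>h. \<Sum>j\<in>UNIV. h $ j * conv f (partial_deriv j \<psi>) x0)"
    by auto
  with D have "((\<lambda>x. integral ?B (\<lambda>y. f y * \<psi> (x - y))) has_derivative
      (\<lambda>h. \<Sum>j\<in>UNIV. h $ j * conv f (partial_deriv j \<psi>) x0)) (at x0 within U)"
    by simp
  then have "(conv f \<psi> has_derivative
      (\<lambda>h. \<Sum>j\<in>UNIV. h $ j * conv f (partial_deriv j \<psi>) x0)) (at x0 within U)"
    by (rule has_derivative_transform_within[where d = 1])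
      (auto simp: conv_eq cont_\<psi> supp U_def)
  moreover have "at x0 within U = at x0"
    by (rule at_within_open) (auto simp: U_def)
  ultimately show ?thesis by simp
qed

lemma partial_deriv_conv:
  fixes f \<psi> :: "real^'n::finite \<Rightarrow> real"
  assumes "continuous_on UNIV f" "C_class (Suc 0) \<psi>" "\<And>z. norm z > r \<Longrightarrow> \<psi> z = 0"
  shows "partial_deriv j (conv f \<psi>) = conv f (partial_deriv j \<psi>)"
proof
  fix x
  have "(\<Sum>i\<in>UNIV. axis j 1 $ i * conv f (partial_deriv i \<psi>) x)
      = (\<Sum>i\<in>UNIV. if i = j then conv f (partial_deriv i \<psi>) x else 0)"
    by (intro sum.cong) (auto simp: axis_def)
  moreover have "partial_deriv j (conv f \<psi>) x = (\<Sum>i\<in>UNIV. axis j 1 $ i * conv f (partial_deriv i \<psi>) x)"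
    by (rule partial_deriv_eq[OF conv_has_derivative[OF assms]])
  ultimately show "partial_deriv j (conv f \<psi>) x = conv f (partial_deriv j \<psi>) x"
    by simp
qed

text \<open>One order is lost because differentiating under the integral asks for a continuous
  gradient of the kernel. For smooth kernels the loss is harmless.\<close>

lemma C_class_conv:
  fixes f \<psi> :: "real^'n::finite \<Rightarrow> real"
  assumes f: "continuous_on UNIV f"
  shows "C_class (Suc m) \<psi> \<Longrightarrow> (\<And>z. norm z > r \<Longrightarrow> \<psi> z = 0) \<Longrightarrow> C_class m (conv f \<psi>)"
proof (induction m arbitrary: \<psi>)
  case 0
  then show ?case
    using has_derivative_continuous[OF conv_has_derivative[OF f]]
    by (auto simp: continuous_on_eq_continuous_at)
next
  case (Suc m)
  have 1: "C_class (Suc 0) \<psi>"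
    using Suc.prems(1) C_class_continuous by (metis C_class.simps)
  have "C_class m (conv f (partial_deriv j \<psi>))" for j
    using Suc.prems(1) partial_deriv_support[OF Suc.prems(2)] by (intro Suc.IH) auto
  then show ?case
    using conv_has_derivative[OF f 1 Suc.prems(2)] partial_deriv_conv[OF f 1 Suc.prems(2)]
    by (auto intro: differentiableI)
qed

lemma C_infinity_conv:
  fixes f \<psi> :: "real^'n::finite \<Rightarrow> real"
  assumes "continuous_on UNIV f" "C_infinity \<psi>" "\<And>z. norm z > r \<Longrightarrow> \<psi> z = 0"
  shows "C_infinity (conv f \<psi>)"
  using assms C_class_conv unfolding C_infinity_def by metis

section \<open>Rescaled kernels and local averages\<close>

lemma integral_affine:
  fixes F :: "'a::euclidean_space \<Rightarrow> real"
  assumes "c \<noteq> 0" "F \<in> borel_measurable borel"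
  shows "(\<integral>x. F x \<partial>lborel) = \<bar>c\<bar> ^ DIM('a) * (\<integral>z. F (t + c *\<^sub>R z) \<partial>lborel)"
proof -
  have m: "(\<lambda>x. t + c *\<^sub>R x) \<in> lborel \<rightarrow>\<^sub>M borel" by measurable
  have "(\<integral>x. F x \<partial>lborel)
      = (\<integral>x. F x \<partial>density (distr lborel borel (\<lambda>x. t + c *\<^sub>R x)) (\<lambda>_. ennreal (\<bar>c\<bar> ^ DIM('a))))"
    by (rule arg_cong[OF lborel_affine[OF assms(1)]])
  also have "\<dots> = (\<integral>x. \<bar>c\<bar> ^ DIM('a) * F x \<partial>distr lborel borel (\<lambda>x. t + c *\<^sub>R x))"
    using assms(2) by (subst integral_density) auto
  also have "\<dots> = (\<integral>x. \<bar>c\<bar> ^ DIM('a) * F (t + c *\<^sub>R x) \<partial>lborel)"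
    using assms(2) by (subst integral_distr[OF m]) auto
  finally show ?thesis by simp
qed

text \<open>The squared norm is spelled out in coordinates so that smoothness follows from the
  closure rules for sums and products; the polynomial 1 selects e^(-1/t).\<close>

definition bump :: "real^'n::finite \<Rightarrow> real" where
  "bump x = flat_exp 1 (1 - (\<Sum>i\<in>UNIV. x $ i * x $ i))"

lemma sum_sq_norm: "(\<Sum>i\<in>UNIV. x $ i * x $ i) = (norm (x::real^'n::finite))\<^sup>2"
  by (simp add: power2_norm_eq_inner inner_vec_def)

lemma C_infinity_bump: "C_infinity bump"
  unfolding bump_def
  by (intro C_infinity_flat_exp C_infinity_diff C_infinity_sum C_infinity_mult
      C_infinity_component C_infinity_const)

lemma bump_nonneg: "bump x \<ge> 0"
  by (simp add: bump_def flat_exp_def)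

lemma bump_pos_iff: "bump x > 0 \<longleftrightarrow> norm x < 1"
  by (simp add: bump_def flat_exp_def sum_sq_norm abs_square_less_1)

lemma bump_integrable: "integrable lborel bump"
proof (rule integrable_continuous_support[of _ 0 1])
  show "bump x = 0" if "x \<notin> cball 0 1" for x :: "real^'n"
    using that bump_pos_iff[of x] bump_nonneg[of x] by auto
qed (use C_infinity_continuous C_infinity_bump in auto)

lemma bump_integral_pos: "(\<integral>x. bump (x::real^'n::finite) \<partial>lborel) > 0"
proof -
  have "(\<integral>x. bump (x::real^'n) \<partial>lborel) \<noteq> 0"
  proof
    assume "(\<integral>x. bump (x::real^'n) \<partial>lborel) = 0"
    then have "AE x in lborel. bump (x::real^'n) = 0"
      using integral_nonneg_eq_0_iff_AE[OF bump_integrable] bump_nonneg by auto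
    then have "AE x in lborel. (x::real^'n) \<notin> ball 0 1"
    proof (rule AE_mp, intro AE_I2 impI)
      fix x :: "real^'n"
      assume "bump x = 0"
      then show "x \<notin> ball 0 1" using bump_pos_iff[of x] by auto
    qed
    then have "ball (0::real^'n) 1 \<in> null_sets lborel"
      by (subst AE_iff_null_sets) auto
    then have "negligible (ball (0::real^'n) 1)"
      by (simp add: negligible_iff_null_sets null_sets_completionI)
    then show False using open_not_negligible[of "ball (0::real^'n) 1"] by auto
  qed
  moreover have "(\<integral>x. bump (x::real^'n) \<partial>lborel) \<ge> 0"
    using bump_nonneg by (intro Bochner_Integration.integral_nonneg)
  ultimately show ?thesis by simp
qed

definition unit_bump :: "real^'n::finite \<Rightarrow> real" where
  "unit_bump x = bump x * inverse (\<integral>x. bump (x::real^'n) \<partial>lborel)"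

lemma C_infinity_unit_bump: "C_infinity unit_bump"
  unfolding unit_bump_def[abs_def] by (intro C_infinity_mult C_infinity_bump C_infinity_const)

lemma unit_bump_nonneg: "unit_bump (x::real^'n::finite) \<ge> 0"
  unfolding unit_bump_def using bump_nonneg[of x] bump_integral_pos[where 'n='n]
  by (intro mult_nonneg_nonneg) auto

lemma unit_bump_support: "norm (x::real^'n::finite) > 1 \<Longrightarrow> unit_bump x = 0"
  using bump_pos_iff[of x] bump_nonneg[of x] by (auto simp: unit_bump_def)

lemma unit_bump_integral: "(\<integral>x. unit_bump (x::real^'n::finite) \<partial>lborel) = 1"
  unfolding unit_bump_def[abs_def] using bump_integral_pos[where 'n='n] by simp

definition moll_ker :: "real \<Rightarrow> real^'n::finite \<Rightarrow> real" where
  "moll_ker N z = N ^ CARD('n) * unit_bump (N *\<^sub>R z)"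

definition mollify :: "real \<Rightarrow> (real^'n::finite \<Rightarrow> real) \<Rightarrow> real^'n \<Rightarrow> real" where
  "mollify N f = conv f (moll_ker N)"

lemma C_infinity_moll_ker: "C_infinity (moll_ker N)"
  using C_infinity_mult[OF C_infinity_const C_infinity_affine[OF C_infinity_unit_bump, of 0 N]]
  by (simp add: moll_ker_def[abs_def])

lemma moll_ker_nonneg: "N \<ge> 0 \<Longrightarrow> moll_ker N z \<ge> 0"
  by (simp add: moll_ker_def unit_bump_nonneg)

lemma moll_ker_support:
  assumes "N > 0" "norm z > 1 / N"
  shows "moll_ker N z = 0"
proof -
  have "norm (N *\<^sub>R z) > 1" using assms by (simp add: field_simps)
  then show ?thesis by (simp add: moll_ker_def unit_bump_support)
qed

lemma moll_ker_support_1: "N \<ge> 1 \<Longrightarrow> norm z > 1 \<Longrightarrow> moll_ker N z = 0"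
  by (rule moll_ker_support) (auto intro: le_less_trans[of _ 1])

lemma partial_deriv_moll_ker:
  "partial_deriv j (moll_ker N) (z::real^'n::finite) = N ^ CARD('n) * N * partial_deriv j unit_bump (N *\<^sub>R z)"
proof -
  have d: "unit_bump differentiable (at x)" for x :: "real^'n"
    by (rule C_infinity_differentiable[OF C_infinity_unit_bump])
  have "(\<lambda>z::real^'n. unit_bump (N *\<^sub>R z)) differentiable (at x)" for x
    using C_infinity_differentiable[OF C_infinity_affine[OF C_infinity_unit_bump, of 0 N]] by simp
  then have "partial_deriv j (moll_ker N) z
      = N ^ CARD('n) * partial_deriv j (\<lambda>z. unit_bump (N *\<^sub>R z)) z"
    unfolding moll_ker_def[abs_def] by (subst partial_deriv_mult) auto
  also have "partial_deriv j (\<lambda>z. unit_bump (N *\<^sub>R z)) z = N * partial_deriv j unit_bump (N *\<^sub>R z)"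
    using partial_deriv_affine(2)[OF d, of j 0 N z] by simp
  finally show ?thesis by simp
qed

text \<open>The substitution z = N (x - y) removes the scaling. A general \<open>\<psi>\<close> is
  allowed so that the same formula serves the kernel and its partial derivatives.\<close>

lemma integral_moll:
  fixes h \<psi> :: "real^'n::finite \<Rightarrow> real"
  assumes N: "N > 0" and [measurable]: "h \<in> borel_measurable borel" "\<psi> \<in> borel_measurable borel"
  shows "(\<integral>y. h y * (N ^ CARD('n) * \<psi> (N *\<^sub>R (x - y))) \<partial>lborel)
       = (\<integral>z. h (x + (- (1 / N)) *\<^sub>R z) * \<psi> z \<partial>lborel)"
proof -
  let ?c = "- (1 / N)"
  have cancel: "N *\<^sub>R (x - (x + ?c *\<^sub>R z)) = z" for z
    using N by simp
  have "(\<integral>y. h y * (N ^ CARD('n) * \<psi> (N *\<^sub>R (x - y))) \<partial>lborel)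
    = \<bar>?c\<bar> ^ DIM(real^'n) * (\<integral>z. h (x + ?c *\<^sub>R z) * (N ^ CARD('n) * \<psi> (N *\<^sub>R (x - (x + ?c *\<^sub>R z)))) \<partial>lborel)"
    by (rule integral_affine) (use N in \<open>simp, measurable\<close>)
  also have "\<dots> = (1 / N) ^ CARD('n) * (\<integral>z. N ^ CARD('n) * (h (x + ?c *\<^sub>R z) * \<psi> z) \<partial>lborel)"
    unfolding cancel using N by (simp add: mult.left_commute)
  also have "\<dots> = (\<integral>z. h (x + ?c *\<^sub>R z) * \<psi> z \<partial>lborel)"
    using N by (simp add: power_divide)
  finally show ?thesis .
qed

lemma moll_ker_integral:
  assumes "N > 0"
  shows "(\<integral>y. moll_ker N (x - y) \<partial>lborel) = 1"
  using integral_moll[OF assms, of "\<lambda>_. 1" unit_bump x] C_infinity_measurable[OF C_infinity_unit_bump]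
  by (simp add: moll_ker_def unit_bump_integral)

lemma C_infinity_mollify:
  fixes f :: "real^'n::finite \<Rightarrow> real"
  assumes "continuous_on UNIV f" "N > 0"
  shows "C_infinity (mollify N f)"
  unfolding mollify_def using C_infinity_conv[OF assms(1) C_infinity_moll_ker moll_ker_support[OF assms(2)]] .

lemma mollify_integrable:
  fixes f :: "real^'n::finite \<Rightarrow> real"
  assumes "continuous_on UNIV f" "N > 0"
  shows "integrable lborel (\<lambda>y. f y * moll_ker N (x - y))"
  using conv_integrable[OF assms(1) C_infinity_continuous[OF C_infinity_moll_ker]
      moll_ker_support[OF assms(2)]] .

lemma moll_ker_integrable: "N > 0 \<Longrightarrow> integrable lborel (\<lambda>y. moll_ker N (x - y))"
  using mollify_integrable[of "\<lambda>_. 1" N x] by simp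

text \<open>The kernel is a probability density supported in the ball of radius 1/N, so a
  mollification is an average of nearby values and inherits their bounds.\<close>

lemma mollify_le:
  fixes f :: "real^'n::finite \<Rightarrow> real"
  assumes f: "continuous_on UNIV f" and N: "N > 0"
    and le: "\<And>y. y \<in> cball x (1 / N) \<Longrightarrow> f y \<le> c"
  shows "mollify N f x \<le> c"
proof -
  have "mollify N f x \<le> (\<integral>y. c * moll_ker N (x - y) \<partial>lborel)"
    unfolding mollify_def conv_def
  proof (rule integral_mono)
    fix y
    show "f y * moll_ker N (x - y) \<le> c * moll_ker N (x - y)"
    proof (cases "y \<in> cball x (1 / N)")
      case True
      then show ?thesis using le moll_ker_nonneg[of N "x - y"] N by (auto intro: mult_right_mono)
    next
      case False
      then have "moll_ker N (x - y) = 0"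
        using moll_ker_support[OF N, of "x - y"] by (auto simp: dist_norm)
      then show ?thesis by simp
    qed
  qed (use mollify_integrable[OF f N] moll_ker_integrable[OF N] in auto)
  then show ?thesis using moll_ker_integral[OF N, of x] by simp
qed

lemma mollify_uminus: "mollify N (\<lambda>x. - f x) x = - mollify N f x"
  by (simp add: mollify_def conv_def)

lemma mollify_ge:
  fixes f :: "real^'n::finite \<Rightarrow> real"
  assumes f: "continuous_on UNIV f" and N: "N > 0"
    and ge: "\<And>y. y \<in> cball x (1 / N) \<Longrightarrow> c \<le> f y"
  shows "c \<le> mollify N f x"
  using mollify_le[of "\<lambda>x. - f x" N x "- c"] assms
  by (simp add: mollify_uminus continuous_on_minus)

lemma mollify_uniform:
  fixes f :: "real^'n::finite \<Rightarrow> real"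
  assumes f: "continuous_on UNIV f" and e: "e > 0"
  shows "\<exists>N0\<ge>1. \<forall>N\<ge>N0. \<forall>x\<in>cball 0 R. \<bar>mollify N f x - f x\<bar> \<le> e"
proof -
  have "uniformly_continuous_on (cball 0 (R + 1)) f"
    by (intro compact_uniformly_continuous continuous_on_subset[OF f]) auto
  then obtain \<delta> where \<delta>: "\<delta> > 0"
    "\<And>x y. x \<in> cball 0 (R + 1) \<Longrightarrow> y \<in> cball 0 (R + 1) \<Longrightarrow> dist y x < \<delta> \<Longrightarrow> dist (f y) (f x) < e"
    unfolding uniformly_continuous_on_def using e by metis
  show ?thesis
  \<comment> \<open>From N >= 2 / \<delta> follows 1/N <= \<delta>/2, strictly below the modulus; N
    >= 1 keeps the averaging inside the larger ball of radius \<open>R + 1\<close>, where uniform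
    continuity was obtained.\<close>
  proof (intro exI[of _ "max 1 (2 / \<delta>)"] conjI allI ballI impI)
    fix N x assume N: "N \<ge> max 1 (2 / \<delta>)" and x: "x \<in> cball (0::real^'n) R"
    then have "1 \<le> N" "2 \<le> N * \<delta>" using \<delta>(1)
      by (auto simp: pos_divide_le_eq)
    then have "1 / N < \<delta>" by (simp add: pos_divide_less_eq mult.commute)
    then have *: "\<bar>f y - f x\<bar> \<le> e" if "y \<in> cball x (1 / N)" for y
    proof -
      have d: "dist y x \<le> 1 / N" using that by (simp add: dist_commute)
      also have "1 / N \<le> 1" using N by simp
      finally have "norm y \<le> R + 1"
        using x norm_triangle_sub[of y x] by (simp add: dist_norm)
      then show ?thesis
        using \<delta>(2)[of x y] x d \<open>1 / N < \<delta>\<close> by (auto simp: dist_real_def)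
    qed
    have pos: "N > 0" using N by auto
    have "f y \<le> f x + e" "f x - e \<le> f y" if "y \<in> cball x (1 / N)" for y
      using *[OF that] by auto
    then have "mollify N f x \<le> f x + e" "f x - e \<le> mollify N f x"
      by (auto intro!: mollify_le[OF f pos] mollify_ge[OF f pos])
    then show "\<bar>mollify N f x - f x\<bar> \<le> e" by linarith
  qed auto
qed

subsection \<open>Weak derivatives along vector fields\<close>

definition lie :: "(real^'n::finite \<Rightarrow> real^'n) \<Rightarrow> (real^'n \<Rightarrow> real) \<Rightarrow> real^'n \<Rightarrow> real" where
  "lie V f x = (\<Sum>j\<in>UNIV. V x $ j * partial_deriv j f x)"

definition smooth_div_free :: "(real^'n::finite \<Rightarrow> real^'n) \<Rightarrow> bool" where
  "smooth_div_free V \<longleftrightarrow> smooth_vector_field V \<and> (\<forall>x. divergence V x = 0)"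

lemma smooth_div_free_component: "smooth_div_free V \<Longrightarrow> C_infinity (\<lambda>x. V x $ j)"
  by (simp add: smooth_div_free_def smooth_vector_field_def)

text \<open>The product rule produces the extra term \<open>\<phi>\<close> times the divergence of
  \<open>V\<close>, which vanishes. This is what makes \<open>V\<close> skew-adjoint up to boundary
  terms.\<close>

lemma lie_eq_divergence:
  fixes \<phi> :: "real^'n::finite \<Rightarrow> real"
  assumes V: "smooth_div_free V" and \<phi>: "C_infinity \<phi>"
  shows "lie V \<phi> x = (\<Sum>j\<in>UNIV. partial_deriv j (\<lambda>y. \<phi> y * V y $ j) x)"
proof -
  have "partial_deriv j (\<lambda>y. \<phi> y * V y $ j) x
      = \<phi> x * partial_deriv j (\<lambda>y. V y $ j) x + V x $ j * partial_deriv j \<phi> x" for j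
    using partial_deriv_mult[OF C_infinity_differentiable[OF \<phi>]
        C_infinity_differentiable[OF smooth_div_free_component[OF V]]] by simp
  moreover have "(\<Sum>j\<in>UNIV. \<phi> x * partial_deriv j (\<lambda>y. V y $ j) x) = 0"
    using V by (simp add: smooth_div_free_def divergence_def flip: sum_distrib_left)
  ultimately show ?thesis by (simp add: sum.distrib lie_def)
qed

lemma formal_adjoint_eq_lie:
  fixes \<phi> :: "real^'n::finite \<Rightarrow> real"
  assumes "smooth_div_free V" "C_infinity \<phi>"
  shows "formal_adjoint V \<phi> = (\<lambda>x. - lie V \<phi> x)"
  by (rule ext) (simp add: lie_eq_divergence[OF assms] formal_adjoint_def divergence_def)

lemma C_infinity_lie:
  assumes "smooth_div_free V" "C_infinity \<phi>"
  shows "C_infinity (lie V \<phi>)"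
  unfolding lie_def[abs_def]
  by (intro C_infinity_sum C_infinity_mult smooth_div_free_component assms C_infinity_partial_deriv)

lemma lie_mult:
  assumes "C_infinity f" "C_infinity g"
  shows "lie V (\<lambda>x. f x * g x) x = f x * lie V g x + lie V f x * g x"
  unfolding lie_def
    partial_deriv_mult[OF C_infinity_differentiable[OF assms(1)] C_infinity_differentiable[OF assms(2)]]
  by (simp add: sum.distrib sum_distrib_left sum_distrib_right algebra_simps)

lemma lie_compose:
  assumes "C_infinity g" "(h has_field_derivative h') (at (g x))"
  shows "lie V (\<lambda>x. h (g x)) x = h' * lie V g x"
  unfolding lie_def partial_deriv_compose(2)[OF C_infinity_differentiable[OF assms(1)] assms(2)]
  by (simp add: sum_distrib_left mult_ac)

lemma lie_support:
  assumes "\<And>z. norm z > r \<Longrightarrow> \<phi> z = 0" "norm z > r"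
  shows "lie V \<phi> z = 0"
  using partial_deriv_support[OF assms] by (simp add: lie_def)

lemma test_functionsI:
  assumes "C_infinity \<phi>" "compact S" "S \<subseteq> U" "\<And>x. x \<notin> S \<Longrightarrow> \<phi> x = 0"
  shows "\<phi> \<in> test_functions U"
proof -
  have "closure {x. \<phi> x \<noteq> 0} \<subseteq> S"
    using assms by (intro closure_minimal) (auto intro: compact_imp_closed)
  then show ?thesis
    using assms closed_Int_compact[OF closed_closure assms(2), of "{x. \<phi> x \<noteq> 0}"]
    by (auto simp: test_functions_def Int_absorb2)
qed

lemma test_functionsI_cball:
  assumes "C_infinity \<phi>" "\<And>z. norm z > r \<Longrightarrow> \<phi> z = 0"
  shows "\<phi> \<in> test_functions UNIV"
  using assms by (intro test_functionsI[where S = "cball 0 r"]) auto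

text \<open>The convolution of the constant 1 with \<open>\<phi>\<close> is a constant function,
  equal to the integral of \<open>\<phi>\<close>. Its derivative is therefore 0, but it is also the
  convolution of 1 with the partial derivative. This replaces an iterated integration.\<close>

lemma integral_partial_deriv:
  fixes \<phi> :: "real^'n::finite \<Rightarrow> real"
  assumes \<phi>: "C_infinity \<phi>" and supp: "\<And>z. norm z > r \<Longrightarrow> \<phi> z = 0"
  shows "(\<integral>x. partial_deriv j \<phi> x \<partial>lborel) = 0"
proof -
  have reflect: "(\<integral>x. F x \<partial>lborel) = (\<integral>y. F (z - y) \<partial>lborel)"
    if "F \<in> borel_measurable borel" for F :: "real^'n \<Rightarrow> real" and z
    using integral_affine[of "-1" F z] that by simp
  have "conv (\<lambda>_. 1) \<phi> z = (\<integral>x. \<phi> x \<partial>lborel)" for z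
    using reflect[OF C_infinity_measurable[OF \<phi>], of z] by (simp add: conv_def)
  then have "conv (\<lambda>_. 1) \<phi> = (\<lambda>z. \<integral>x. \<phi> x \<partial>lborel)" by auto
  then have "partial_deriv j (conv (\<lambda>_. 1) \<phi>) 0 = 0" by simp
  moreover have "C_class (Suc 0) \<phi>" using \<phi> unfolding C_infinity_def by blast
  ultimately have "conv (\<lambda>_. 1) (partial_deriv j \<phi>) 0 = 0"
    using partial_deriv_conv[of "\<lambda>_. 1" \<phi> r j] supp by simp
  then show ?thesis
    using reflect[OF C_infinity_measurable[OF C_infinity_partial_deriv[OF \<phi>]], of j 0]
    by (simp add: conv_def)
qed

lemma integral_lie:
  fixes \<phi> :: "real^'n::finite \<Rightarrow> real"
  assumes V: "smooth_div_free V" and \<phi>: "C_infinity \<phi>" and supp: "\<And>z. norm z > r \<Longrightarrow> \<phi> z = 0"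
  shows "(\<integral>x. lie V \<phi> x \<partial>lborel) = 0"
proof -
  have C: "C_infinity (\<lambda>y. \<phi> y * V y $ j)" for j
    by (intro C_infinity_mult \<phi> smooth_div_free_component V)
  have s: "norm z > r \<Longrightarrow> \<phi> z * V z $ j = 0" for z j using supp by simp
  have "integrable lborel (partial_deriv j (\<lambda>y. \<phi> y * V y $ j))" for j
    using C_infinity_continuous[OF C_infinity_partial_deriv[OF C, of j j]]
      partial_deriv_support[of r "\<lambda>y. \<phi> y * V y $ j", OF s]
    by (intro integrable_continuous_support[of _ 0 r]) auto
  then show ?thesis
    unfolding lie_eq_divergence[OF V \<phi>]
    using integral_partial_deriv[OF C s] by (subst Bochner_Integration.integral_sum) auto
qed

lemma integral_lie_by_parts:
  fixes f \<psi> :: "real^'n::finite \<Rightarrow> real"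
  assumes V: "smooth_div_free V" and f: "C_infinity f" and \<psi>: "C_infinity \<psi>"
    and supp: "\<And>z. norm z > r \<Longrightarrow> \<psi> z = 0"
  shows "(\<integral>x. lie V f x * \<psi> x \<partial>lborel) = - (\<integral>x. f x * lie V \<psi> x \<partial>lborel)"
proof -
  have "integrable lborel (\<lambda>x. f x * lie V \<psi> x)"
    using lie_support[of r \<psi>, OF supp]
    by (intro integrable_continuous_support[of _ 0 r] continuous_on_mult
        C_infinity_continuous f C_infinity_lie V \<psi>) auto
  moreover have "integrable lborel (\<lambda>x. lie V f x * \<psi> x)"
    using supp by (intro integrable_continuous_support[of _ 0 r] continuous_on_mult
        C_infinity_continuous f C_infinity_lie V \<psi>) auto
  moreover have "(\<integral>x. f x * lie V \<psi> x + lie V f x * \<psi> x \<partial>lborel) = 0"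
    using integral_lie[OF V C_infinity_mult[OF f \<psi>], of r] supp lie_mult[OF f \<psi>, of V] by simp
  ultimately show ?thesis by simp
qed

lemma is_weak_derivD:
  fixes f \<phi> :: "real^'n::finite \<Rightarrow> real"
  assumes w: "is_weak_deriv V f g" and V: "smooth_div_free V" and \<phi>: "C_infinity \<phi>"
    and supp: "\<And>z. norm z > r \<Longrightarrow> \<phi> z = 0"
  shows "(\<integral>x. g x * \<phi> x \<partial>lborel) = - (\<integral>x. f x * lie V \<phi> x \<partial>lborel)"
  using w test_functionsI_cball[of \<phi> r, OF \<phi> supp]
  by (auto simp: is_weak_deriv_def distr_eq_on_def distr_deriv_def regular_distr_def
      formal_adjoint_eq_lie[OF V \<phi>])

lemma is_weak_deriv_measurable: "is_weak_deriv V f g \<Longrightarrow> g \<in> borel_measurable borel"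
  by (simp add: is_weak_deriv_def Linfty_loc_def)

lemma is_weak_deriv_bounded:
  fixes f :: "real^'n::finite \<Rightarrow> real"
  assumes "is_weak_deriv V f g"
  shows "\<exists>M\<ge>0. AE x in lborel. x \<in> cball 0 r \<longrightarrow> \<bar>g x\<bar> \<le> M"
proof -
  have "compact (cball (0::real^'n) r)" by simp
  with assms obtain M where "AE x in lborel. x \<in> cball 0 r \<longrightarrow> \<bar>g x\<bar> \<le> M"
    unfolding is_weak_deriv_def Linfty_loc_def by blast
  then have "AE x in lborel. x \<in> cball 0 r \<longrightarrow> \<bar>g x\<bar> \<le> \<bar>M\<bar>"
    by (rule AE_mp) auto
  then show ?thesis by (intro exI[of _ "\<bar>M\<bar>"]) auto
qed

lemma C_infinity_lipschitz_on_cball: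
  fixes h :: "real^'n::finite \<Rightarrow> real"
  assumes h: "C_infinity h"
  shows "\<exists>L\<ge>0. \<forall>x\<in>cball 0 r. \<forall>y\<in>cball 0 r. \<bar>h x - h y\<bar> \<le> L * norm (x - y)"
proof -
  have "\<forall>j. \<exists>B\<ge>0. \<forall>x\<in>cball 0 r. \<bar>partial_deriv j h x\<bar> \<le> B"
    using continuous_bounded_on_cball[OF C_infinity_continuous[OF C_infinity_partial_deriv[OF h]]]
    by blast
  then obtain B where B: "\<And>j. B j \<ge> 0" "\<And>j x. x \<in> cball 0 r \<Longrightarrow> \<bar>partial_deriv j h x\<bar> \<le> B j"
    by metis
  let ?L = "\<Sum>j\<in>UNIV. B j"
  have "norm (h x - h y) \<le> ?L * norm (x - y)" if "x \<in> cball 0 r" "y \<in> cball 0 r" for x y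
  proof (rule differentiable_bound[where S = "cball 0 r"])
    fix x :: "real^'n"
    assume x: "x \<in> cball 0 r"
    show "(h has_derivative (\<lambda>v. \<Sum>j\<in>UNIV. v $ j * partial_deriv j h x)) (at x within cball 0 r)"
      by (rule has_derivative_at_withinI[OF has_derivative_partial_deriv[OF C_infinity_differentiable[OF h]]])
    show "onorm (\<lambda>v. \<Sum>j\<in>UNIV. v $ j * partial_deriv j h x) \<le> ?L"
    proof (rule onorm_le)
      fix v :: "real^'n"
      have "norm (\<Sum>j\<in>UNIV. v $ j * partial_deriv j h x) \<le> (\<Sum>j\<in>UNIV. norm v * B j)"
        using B(2)[OF x] by (intro sum_norm_le) (auto simp: abs_mult intro!: mult_mono component_le_norm_cart)
      then show "norm (\<Sum>j\<in>UNIV. v $ j * partial_deriv j h x) \<le> ?L * norm v"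
        by (simp add: sum_distrib_left mult.commute)
    qed
  qed (use that in auto)
  then show ?thesis using B(1) by (intro exI[of _ ?L]) (auto intro: sum_nonneg)
qed

lemma mollify_bounded:
  fixes f :: "real^'n::finite \<Rightarrow> real"
  assumes f: "continuous_on UNIV f"
  shows "\<exists>M\<ge>0. \<forall>N\<ge>1. \<forall>x\<in>cball 0 R. \<bar>mollify N f x\<bar> \<le> M"
proof -
  obtain M where M: "M \<ge> 0" "\<And>x. x \<in> cball 0 (R + 1) \<Longrightarrow> \<bar>f x\<bar> \<le> M"
    using continuous_bounded_on_cball[OF f, of 0 "R + 1"] by auto
  have "\<bar>mollify N f x\<bar> \<le> M" if N: "N \<ge> 1" and x: "x \<in> cball 0 R" for N x
  proof -
    have pos: "N > 0" using N by simp
    have "\<bar>f y\<bar> \<le> M" if "y \<in> cball x (1 / N)" for y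
    proof -
      have "dist y x \<le> 1 / N" using that by (simp add: dist_commute)
      also have "\<dots> \<le> 1" using N by simp
      finally have "norm y \<le> R + 1"
        using x norm_triangle_sub[of y x] by (simp add: dist_norm)
      then show ?thesis using M by simp
    qed
    then have "f y \<le> M" "- M \<le> f y" if "y \<in> cball x (1 / N)" for y
      using that by (fastforce simp: abs_le_iff)+
    then show ?thesis
      using mollify_le[OF f pos, of x M] mollify_ge[OF f pos, of x "- M"] by (simp add: abs_le_iff)
  qed
  with M(1) show ?thesis by blast
qed

lemma mollify_tendsto:
  fixes f :: "real^'n::finite \<Rightarrow> real"
  assumes f: "continuous_on UNIV f"
  shows "(\<lambda>n. mollify (real (Suc n)) f x) \<longlonglongrightarrow> f x"
proof (rule LIMSEQ_I)
  fix e :: real assume "e > 0"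
  then have "e / 2 > 0" by simp
  then obtain N0 where "\<forall>N\<ge>N0. \<forall>y\<in>cball 0 (norm x). \<bar>mollify N f y - f y\<bar> \<le> e / 2"
    using mollify_uniform[OF f, of "e / 2" "norm x"] by blast
  then have N0: "\<bar>mollify N f x - f x\<bar> \<le> e / 2" if "N \<ge> N0" for N
    using that by simp
  obtain n0 where "real n0 \<ge> N0" using real_arch_simple by blast
  then have "norm (mollify (real (Suc n)) f x - f x) < e" if "n \<ge> n0" for n
    using N0[of "real (Suc n)"] that \<open>e > 0\<close> by auto
  then show "\<exists>n0. \<forall>n\<ge>n0. norm (mollify (real (Suc n)) f x - f x) < e" by blast
qed

lemma abs_integral_le:
  fixes f :: "'a \<Rightarrow> real"
  assumes "f \<in> borel_measurable M" "integrable M g" "AE x in M. \<bar>f x\<bar> \<le> g x"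
  shows "\<bar>\<integral>x. f x \<partial>M\<bar> \<le> (\<integral>x. g x \<partial>M)"
proof -
  have "integrable M f"
    using assms(1,3) by (intro Bochner_Integration.integrable_bound[OF assms(2)]) (auto elim!: eventually_mono)
  then have "(\<integral>x. norm (f x) \<partial>M) \<le> (\<integral>x. g x \<partial>M)"
    using assms by (intro integral_mono_AE) auto
  then show ?thesis
    by (intro order_trans[OF integral_abs_bound]) simp
qed

text \<open>
  Friedrichs' commutator estimate: testing the weak derivative with the kernel turns the derivative of
  the mollification into a difference \<open>V x - V y\<close>, whose smallness compensates the factor \<open>N\<close> lost by
  differentiating the kernel.
\<close>

lemma lie_mollify_bounded:
  fixes f :: "real^'n::finite \<Rightarrow> real"
  assumes f: "continuous_on UNIV f" and V: "smooth_div_free V" and w: "is_weak_deriv V f g"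
  shows "\<exists>M\<ge>0. \<forall>N\<ge>1. \<forall>x\<in>cball 0 R. \<bar>lie V (mollify N f) x\<bar> \<le> M"
proof -
  \<comment> \<open>All bounds are taken on radius \<open>R + 1\<close>, because a kernel with N >=
    1 centred in the ball of radius \<open>R\<close> reaches at most distance 1 further.\<close>
  obtain A where A: "A \<ge> 0" "\<And>x. x \<in> cball 0 (R + 1) \<Longrightarrow> \<bar>f x\<bar> \<le> A"
    using continuous_bounded_on_cball[OF f, of 0 "R + 1"] by auto
  have "\<forall>j. \<exists>L\<ge>0. \<forall>x\<in>cball 0 (R + 1). \<forall>y\<in>cball 0 (R + 1). \<bar>V x $ j - V y $ j\<bar> \<le> L * norm (x - y)"
    using C_infinity_lipschitz_on_cball[OF smooth_div_free_component[OF V]] by blast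
  then obtain L where L: "\<And>j. L j \<ge> 0"
    "\<And>j x y. x \<in> cball 0 (R + 1) \<Longrightarrow> y \<in> cball 0 (R + 1) \<Longrightarrow> \<bar>V x $ j - V y $ j\<bar> \<le> L j * norm (x - y)"
    by metis
  obtain B where B: "B \<ge> 0" "AE x in lborel. x \<in> cball 0 (R + 1) \<longrightarrow> \<bar>g x\<bar> \<le> B"
    using is_weak_deriv_bounded[OF w] by blast
  define P :: "'n \<Rightarrow> real^'n \<Rightarrow> real" where "P j = partial_deriv j unit_bump" for j
  have P_cont: "continuous_on UNIV (P j)" for j
    unfolding P_def by (intro C_infinity_continuous C_infinity_partial_deriv C_infinity_unit_bump)
  have P_supp: "norm z > 1 \<Longrightarrow> P j z = 0" for j z
    unfolding P_def using partial_deriv_support[of 1 unit_bump] unit_bump_support by blast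
  have P_int: "integrable lborel (P j)" for j
    using P_cont P_supp by (intro integrable_continuous_support[of _ 0 1]) auto
  have V_cont: "continuous_on UNIV (\<lambda>y. V y $ j)" for j
    by (intro C_infinity_continuous smooth_div_free_component V)
  have [measurable]: "f \<in> borel_measurable borel" "P j \<in> borel_measurable borel"
    "(\<lambda>y. V y $ j) \<in> borel_measurable borel" for j
    using f P_cont V_cont by (auto intro: borel_measurable_continuous_onI)
  note [measurable] = is_weak_deriv_measurable[OF w]
  \<comment> \<open>The sum bounds the commutator, one term per coordinate; \<open>B\<close> bounds
    the average of the weak derivative \<open>g\<close>. Neither depends on
    \<open>N\<close>.\<close>
  let ?M = "(\<Sum>j\<in>UNIV. A * L j * (\<integral>z. \<bar>P j z\<bar> \<partial>lborel)) + B"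
  have "\<bar>lie V (mollify N f) x\<bar> \<le> ?M" if N: "N \<ge> 1" and x: "x \<in> cball 0 R" for N x
  proof -
    have pos: "N > 0" using N by simp
    let ?k = "moll_ker N :: real^'n \<Rightarrow> real"
    define q where "q y = ?k (x - y)" for y
    have k: "?k differentiable (at z)" for z
      by (rule C_infinity_differentiable[OF C_infinity_moll_ker])
    have q: "C_infinity q"
      using C_infinity_affine[OF C_infinity_moll_ker, where a = x and c = "-1"] by (simp add: q_def[abs_def])
    have near: "norm y \<le> R + 1" if "norm (x - y) \<le> 1" for y
      using that x norm_triangle_sub[of y x] by (simp add: norm_minus_commute)
    have q_supp: "norm y > R + 1 \<Longrightarrow> q y = 0" for y
      using near[of y] moll_ker_support_1[OF N, of "x - y"] by (force simp: q_def)
    have lie_q: "lie V q y = - (\<Sum>j\<in>UNIV. V y $ j * partial_deriv j ?k (x - y))" for y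
      using partial_deriv_affine(2)[OF k, of _ x "-1" y]
      by (simp add: lie_def q_def[abs_def] sum_negf)
    have pk: "continuous_on UNIV (partial_deriv j ?k)" "norm z > 1 \<Longrightarrow> partial_deriv j ?k z = 0" for j z
      using C_infinity_continuous[OF C_infinity_partial_deriv[OF C_infinity_moll_ker]]
        partial_deriv_support[of 1 ?k] moll_ker_support_1[OF N] by blast+
    have int: "integrable lborel (\<lambda>y. (f y * u y) * partial_deriv j ?k (x - y))"
      if "continuous_on UNIV u" for u j
      using conv_integrable[OF continuous_on_mult[OF f that] pk(1), of 1] pk(2) by auto
    have "C_class (Suc 0) ?k" using C_infinity_moll_ker unfolding C_infinity_def by blast
    then have "partial_deriv j (mollify N f) x = (\<integral>y. f y * partial_deriv j ?k (x - y) \<partial>lborel)" for j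
      unfolding mollify_def
      using partial_deriv_conv[of f ?k 1 j, OF f _ moll_ker_support_1[OF N]] by (simp add: conv_def)
    then have 1: "lie V (mollify N f) x
        = (\<Sum>j\<in>UNIV. \<integral>y. (f y * V x $ j) * partial_deriv j ?k (x - y) \<partial>lborel)"
      by (simp add: lie_def flip: Bochner_Integration.integral_mult_right_zero) (simp add: mult_ac)
    \<comment> \<open>Here the kernel centred at \<open>x\<close> is the test function in
      \<open>y\<close>. The sign from the reflected argument cancels the minus sign of the weak
      derivative, and the outcome differs from \<open>1\<close> only by \<open>V y\<close> in place
      of \<open>V x\<close>.\<close>
    have "(\<integral>y. g y * q y \<partial>lborel) = - (\<integral>y. f y * lie V q y \<partial>lborel)"
      by (rule is_weak_derivD[OF w V q q_supp])
    also have "\<dots> = (\<integral>y. (\<Sum>j\<in>UNIV. (f y * V y $ j) * partial_deriv j ?k (x - y)) \<partial>lborel)"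
      by (simp add: lie_q sum_distrib_left mult_ac)
    also have "\<dots> = (\<Sum>j\<in>UNIV. \<integral>y. (f y * V y $ j) * partial_deriv j ?k (x - y) \<partial>lborel)"
      by (intro Bochner_Integration.integral_sum int V_cont)
    finally have 2: "(\<integral>y. g y * q y \<partial>lborel)
        = (\<Sum>j\<in>UNIV. \<integral>y. (f y * V y $ j) * partial_deriv j ?k (x - y) \<partial>lborel)" .
    have "\<bar>(\<integral>y. (f y * V x $ j) * partial_deriv j ?k (x - y) \<partial>lborel)
        - (\<integral>y. (f y * V y $ j) * partial_deriv j ?k (x - y) \<partial>lborel)\<bar>
        \<le> A * L j * (\<integral>z. \<bar>P j z\<bar> \<partial>lborel)" (is "\<bar>?d\<bar> \<le> _") for j
    proof -
      define h where "h y = f y * (V x $ j - V y $ j)" for y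
      have [measurable]: "h \<in> borel_measurable borel" unfolding h_def[abs_def] by measurable
      have "?d = (\<integral>y. (f y * V x $ j) * partial_deriv j ?k (x - y)
          - (f y * V y $ j) * partial_deriv j ?k (x - y) \<partial>lborel)"
        by (intro Bochner_Integration.integral_diff[symmetric] int V_cont continuous_on_const)
      \<comment> \<open>Beyond the normalising power, differentiating the kernel leaves a factor
        \<open>N\<close>. After rescaling, \<open>h\<close> is evaluated at distance at most 1/N
        from \<open>x\<close>, where the Lipschitz bound on \<open>V\<close> contributes
        1/N.\<close>
      also have "\<dots> = (\<integral>y. h y * (N ^ CARD('n) * (N * P j (N *\<^sub>R (x - y)))) \<partial>lborel)"
        by (simp add: partial_deriv_moll_ker P_def h_def algebra_simps)
      also have "\<dots> = (\<integral>z. h (x + (- (1 / N)) *\<^sub>R z) * (N * P j z) \<partial>lborel)"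
        by (rule integral_moll[OF pos, of h "\<lambda>z. N * P j z"]) measurable
      finally have "?d = (\<integral>z. h (x + (- (1 / N)) *\<^sub>R z) * (N * P j z) \<partial>lborel)" .
      moreover have "\<bar>\<integral>z. h (x + (- (1 / N)) *\<^sub>R z) * (N * P j z) \<partial>lborel\<bar>
          \<le> (\<integral>z. A * L j * \<bar>P j z\<bar> \<partial>lborel)"
      proof (rule abs_integral_le)
        show "AE z in lborel. \<bar>h (x + (- (1 / N)) *\<^sub>R z) * (N * P j z)\<bar> \<le> A * L j * \<bar>P j z\<bar>"
        proof (rule AE_I2)
          fix z :: "real^'n"
          show "\<bar>h (x + (- (1 / N)) *\<^sub>R z) * (N * P j z)\<bar> \<le> A * L j * \<bar>P j z\<bar>"
          proof (cases "norm z \<le> 1")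
            case True
            let ?y = "x + (- (1 / N)) *\<^sub>R z"
            have d: "norm (x - ?y) \<le> 1 / N"
              using True pos by (simp add: divide_right_mono)
            also have "1 / N \<le> 1" using N by simp
            finally have y: "?y \<in> cball 0 (R + 1)" using near[of ?y] by simp
            have xx: "x \<in> cball 0 (R + 1)" using x by simp
            have "\<bar>V x $ j - V ?y $ j\<bar> \<le> L j * (1 / N)"
              using L(2)[OF xx y, of j] mult_left_mono[OF d L(1)[of j]] by linarith
            then have "\<bar>h ?y\<bar> \<le> A * (L j * (1 / N))"
              unfolding h_def abs_mult using A(2)[OF y] A(1) by (intro mult_mono) auto
            then have "\<bar>h ?y\<bar> * (N * \<bar>P j z\<bar>) \<le> A * (L j * (1 / N)) * (N * \<bar>P j z\<bar>)"
              using pos by (intro mult_right_mono) auto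
            also have "\<dots> = A * L j * \<bar>P j z\<bar>" using pos by simp
            finally show ?thesis using pos by (simp add: abs_mult)
          next
            case False
            then show ?thesis using P_supp by simp
          qed
        qed
      qed (use P_int in auto)
      ultimately show ?thesis by simp
    qed
    then have "\<bar>lie V (mollify N f) x - (\<integral>y. g y * q y \<partial>lborel)\<bar>
        \<le> (\<Sum>j\<in>UNIV. A * L j * (\<integral>z. \<bar>P j z\<bar> \<partial>lborel))"
      unfolding 1 2 sum_subtractf[symmetric] by (intro order_trans[OF sum_abs] sum_mono)
    moreover have "\<bar>\<integral>y. g y * q y \<partial>lborel\<bar> \<le> (\<integral>y. B * q y \<partial>lborel)"
    proof (rule abs_integral_le)
      show "AE y in lborel. \<bar>g y * q y\<bar> \<le> B * q y"
        using B(2)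
      proof eventually_elim
        case (elim y)
        have "q y \<ge> 0" using moll_ker_nonneg[of N] pos by (simp add: q_def)
        then show ?case
          using elim q_supp[of y] by (cases "norm y > R + 1") (auto simp: abs_mult intro!: mult_right_mono)
      qed
      show "integrable lborel (\<lambda>y. B * q y)"
        using moll_ker_integrable[OF pos, of x] by (simp add: q_def[abs_def])
    qed (use C_infinity_measurable[OF q] in measurable)
    moreover have "(\<integral>y. B * q y \<partial>lborel) = B"
      using moll_ker_integral[OF pos, of x] by (simp add: q_def)
    ultimately show ?thesis by linarith
  qed
  moreover have "?M \<ge> 0"
    using A(1) L(1) B(1) by (intro add_nonneg_nonneg sum_nonneg mult_nonneg_nonneg) auto
  ultimately show ?thesis by blast
qed


text \<open>Continuous functions converging to \<open>h\<close> almost everywhere are truncated in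
  size and in space, which gives L1 convergence by domination; one of them is then mollified. The
  spatial cutoff and the mollification each enlarge the support radius by 1, hence
  \<open>R + 2\<close>.\<close>

lemma L1_approx_test_function:
  fixes h :: "real^'n::finite \<Rightarrow> real"
  assumes meas[measurable]: "h \<in> borel_measurable borel"
    and bound: "AE x in lborel. \<bar>h x\<bar> \<le> M * indicator (cball 0 R) x" and e: "e > 0"
  shows "\<exists>\<psi>. C_infinity \<psi> \<and> (\<forall>x. norm x > R + 2 \<longrightarrow> \<psi> x = 0) \<and> (\<integral>x. \<bar>h x - \<psi> x\<bar> \<partial>lborel) \<le> e"
proof -
  have int_h: "integrable lborel h"
    by (rule integrable_bounded_support[OF meas bound])
  have "h measurable_on UNIV"
  proof (rule lebesgue_measurable_imp_measurable_on)
    show "h \<in> borel_measurable lebesgue" by (rule measurable_completion) simp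
  qed simp
  then obtain S g where S: "negligible S" and g: "\<And>n. continuous_on UNIV (g n)"
    and lim: "\<And>x. x \<notin> S \<Longrightarrow> (\<lambda>n. g n x) \<longlonglongrightarrow> h x"
    unfolding measurable_on_def by auto
  have AE_S: "AE x in lborel. x \<notin> S"
  proof -
    have "AE x in lebesgue. x \<notin> S"
      using S by (intro AE_not_in) (simp add: negligible_iff_null_sets)
    then show ?thesis by (simp add: AE_completion_iff)
  qed
  \<comment> \<open>\<open>\<theta>\<close> is 1 on the ball of radius \<open>R\<close> and 0 beyond
    \<open>R + 1\<close>, and the truncation level is at least |h| almost everywhere, so neither
    changes \<open>h\<close> in the limit. The absolute value of \<open>M\<close> is used because no
    sign of \<open>M\<close> is assumed.\<close>
  define \<theta> where "\<theta> x = max 0 (min 1 (R + 1 - norm x))" for x :: "real^'n"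
  define c where "c n x = \<theta> x * max (- \<bar>M\<bar>) (min \<bar>M\<bar> (g n x))" for n x
  have c_cont: "continuous_on UNIV (c n)" for n
    unfolding c_def[abs_def] \<theta>_def[abs_def] using g
    by (intro continuous_intros) auto
  have c_supp: "c n x = 0" if "norm x > R + 1" for n x
    using that by (simp add: c_def \<theta>_def)
  have c_bound: "\<bar>c n x\<bar> \<le> \<bar>M\<bar> * indicator (cball 0 (R + 1)) x" for n x
  proof (cases "norm x > R + 1")
    case False
    have "\<bar>c n x\<bar> \<le> 1 * \<bar>M\<bar>"
      unfolding c_def abs_mult by (intro mult_mono) (auto simp: \<theta>_def)
    then show ?thesis using False by simp
  qed (simp add: c_supp)
  have "(\<lambda>n. \<integral>x. \<bar>h x - c n x\<bar> \<partial>lborel) \<longlonglongrightarrow> (\<integral>x. 0 \<partial>(lborel :: (real^'n) measure))"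
  proof (rule integral_dominated_convergence)
    show "integrable lborel (\<lambda>x. \<bar>h x\<bar> + \<bar>M\<bar> * indicator (cball 0 (R + 1)) x)"
      using int_h emeasure_lborel_cball_finite[of "0::real^'n" "R + 1"]
      by (intro Bochner_Integration.integrable_add integrable_abs integrable_mult_right
          integrable_real_indicator) auto
    show "AE x in lborel. (\<lambda>n. \<bar>h x - c n x\<bar>) \<longlonglongrightarrow> 0"
      using AE_S bound
    proof eventually_elim
      case (elim x)
      have "(\<lambda>n. c n x) \<longlonglongrightarrow> \<theta> x * max (- \<bar>M\<bar>) (min \<bar>M\<bar> (h x))"
        unfolding c_def by (intro tendsto_intros lim elim)
      moreover have "\<theta> x * max (- \<bar>M\<bar>) (min \<bar>M\<bar> (h x)) = h x"
        using elim(2) by (cases "norm x \<le> R") (auto simp: \<theta>_def)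
      ultimately have "(\<lambda>n. \<bar>h x - c n x\<bar>) \<longlonglongrightarrow> \<bar>h x - h x\<bar>"
        by (intro tendsto_intros) simp
      then show ?case by simp
    qed
    show "AE x in lborel. norm \<bar>h x - c n x\<bar> \<le> \<bar>h x\<bar> + \<bar>M\<bar> * indicator (cball 0 (R + 1)) x" for n
    proof (rule AE_I2)
      fix x show "norm \<bar>h x - c n x\<bar> \<le> \<bar>h x\<bar> + \<bar>M\<bar> * indicator (cball 0 (R + 1)) x"
        using c_bound[of n x] by simp
    qed
    show "(\<lambda>x. \<bar>h x - c n x\<bar>) \<in> borel_measurable lborel" for n
      using borel_measurable_continuous_onI[OF c_cont[of n]] by measurable
  qed simp
  then have "(\<lambda>n. \<integral>x. \<bar>h x - c n x\<bar> \<partial>lborel) \<longlonglongrightarrow> 0" by simp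
  then have "\<forall>\<^sub>F n in sequentially. (\<integral>x. \<bar>h x - c n x\<bar> \<partial>lborel) < e / 2"
    using e by (intro order_tendstoD) auto
  then obtain n where n: "(\<integral>x. \<bar>h x - c n x\<bar> \<partial>lborel) < e / 2"
    by (auto simp: eventually_sequentially)
  define vol where "vol = measure lborel (cball (0::real^'n) (R + 2))"
  \<comment> \<open>A uniform error \<open>e'\<close> on the ball of volume \<open>vol\<close> costs
    at most e/2 in L1; the summand 1 keeps the denominator positive.\<close>
  define e' where "e' = e / (2 * (vol + 1))"
  have vol: "vol \<ge> 0" by (simp add: vol_def)
  then have e': "e' > 0" "e' * vol \<le> e / 2"
    using e by (auto simp: e'_def field_simps)
  obtain N where N: "N \<ge> 1" "\<forall>x\<in>cball 0 (R + 2). \<bar>mollify N (c n) x - c n x\<bar> \<le> e'"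
    using mollify_uniform[where R = "R + 2", OF c_cont[of n] e'(1)] by blast
  define \<psi> where "\<psi> = mollify N (c n)"
  have pos: "N > 0" using N by simp
  have \<psi>_supp: "\<psi> x = 0" if x: "norm x > R + 2" for x
  proof -
    have "c n y = 0" if "y \<in> cball x (1 / N)" for y
    proof (rule c_supp)
      have "norm (x - y) \<le> 1 / N" using that by (simp add: dist_norm)
      also have "1 / N \<le> 1" using N(1) by simp
      finally show "norm y > R + 1"
        using x norm_triangle_sub[of x y] by simp
    qed
    then have "\<psi> x \<le> 0" "\<psi> x \<ge> 0"
      unfolding \<psi>_def by (auto intro!: mollify_le[OF c_cont pos] mollify_ge[OF c_cont pos])
    then show ?thesis by simp
  qed
  have \<psi>: "C_infinity \<psi>"
    unfolding \<psi>_def by (rule C_infinity_mollify[OF c_cont pos])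
  have int_c: "integrable lborel (c n)"
    using c_cont c_supp by (intro integrable_continuous_support[of _ 0 "R + 1"]) auto
  have int_\<psi>: "integrable lborel \<psi>"
    using C_infinity_continuous[OF \<psi>] \<psi>_supp by (intro integrable_continuous_support[of _ 0 "R + 2"]) auto
  have ind: "integrable lborel (\<lambda>x. e' * indicator (cball (0::real^'n) (R + 2)) x)"
    using emeasure_lborel_cball_finite[of "0::real^'n" "R + 2"]
    by (intro integrable_mult_right integrable_real_indicator) auto
  have "(\<integral>x. \<bar>h x - \<psi> x\<bar> \<partial>lborel)
      \<le> (\<integral>x. \<bar>h x - c n x\<bar> + e' * indicator (cball 0 (R + 2)) x \<partial>lborel)"
  proof (rule integral_mono)
    fix x
    show "\<bar>h x - \<psi> x\<bar> \<le> \<bar>h x - c n x\<bar> + e' * indicator (cball 0 (R + 2)) x"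
    proof (cases "norm x > R + 2")
      case True
      then show ?thesis using \<psi>_supp[of x] c_supp[of x n] by simp
    next
      case False
      then have "\<bar>\<psi> x - c n x\<bar> \<le> e'" using N(2) by (simp add: \<psi>_def)
      then show ?thesis using False by simp
    qed
  qed (use int_h int_c int_\<psi> ind in auto)
  also have "\<dots> = (\<integral>x. \<bar>h x - c n x\<bar> \<partial>lborel) + e' * vol"
    using int_h int_c ind by (subst Bochner_Integration.integral_add) (auto simp: vol_def)
  also have "\<dots> \<le> e" using n e'(2) by simp
  finally show ?thesis using \<psi> \<psi>_supp by blast
qed

text \<open>A density argument: replacing \<open>h\<close> by a test function costs at most a sup
  bound times an L1 distance. The sup bounds for the mollified derivatives are uniform in
  \<open>n\<close>, so the cost is uniform as well.\<close>

lemma weak_star_mollify: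
  fixes f h :: "real^'n::finite \<Rightarrow> real"
  assumes f: "continuous_on UNIV f" and V: "smooth_div_free V" and w: "is_weak_deriv V f g"
    and h[measurable]: "h \<in> borel_measurable borel"
    and bound: "AE x in lborel. \<bar>h x\<bar> \<le> M * indicator (cball 0 R) x"
  shows "(\<lambda>n. \<integral>x. lie V (mollify (real (Suc n)) f) x * h x \<partial>lborel) \<longlonglongrightarrow> (\<integral>x. g x * h x \<partial>lborel)"
proof -
  let ?a = "\<lambda>n. lie V (mollify (real (Suc n)) f)"
  have a_smooth: "C_infinity (?a n)" for n
    by (intro C_infinity_lie V C_infinity_mollify f) simp
  note [measurable] = is_weak_deriv_measurable[OF w] C_infinity_measurable[OF a_smooth]
  obtain B1 where B1: "B1 \<ge> 0" "\<And>N x. N \<ge> 1 \<Longrightarrow> x \<in> cball 0 (R + 2) \<Longrightarrow> \<bar>lie V (mollify N f) x\<bar> \<le> B1"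
    using lie_mollify_bounded[OF f V w, of "R + 2"] by blast
  obtain B2 where B2: "B2 \<ge> 0" "AE x in lborel. x \<in> cball 0 (R + 2) \<longrightarrow> \<bar>g x\<bar> \<le> B2"
    using is_weak_deriv_bounded[OF w] by blast
  have int_h: "integrable lborel h"
    by (rule integrable_bounded_support[OF h bound])
  show ?thesis
  proof (rule LIMSEQ_I)
    fix e :: real assume e: "e > 0"
    \<comment> \<open>Exchanging \<open>h\<close> for \<open>\<psi>\<close> happens twice, once
      against the mollified derivatives (bound \<open>B1\<close>) and once against \<open>g\<close>
      (bound \<open>B2\<close>). Together this may cost e/2; the other half is left for the
      convergence against \<open>\<psi>\<close>.\<close>
    define e' where "e' = e / (2 * (B1 + B2 + 1))"
    have e': "e' > 0" "(B1 + B2) * e' \<le> e / 2"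
      using e B1(1) B2(1) by (auto simp: e'_def field_simps)
    obtain \<psi> where \<psi>: "C_infinity \<psi>" and supp: "\<And>x. norm x > R + 2 \<Longrightarrow> \<psi> x = 0"
      and close: "(\<integral>x. \<bar>h x - \<psi> x\<bar> \<partial>lborel) \<le> e'"
      using L1_approx_test_function[OF h bound e'(1)] by blast
    note [measurable] = C_infinity_measurable[OF \<psi>]
    have int_\<psi>: "integrable lborel \<psi>"
      using C_infinity_continuous[OF \<psi>] supp by (intro integrable_continuous_support[of _ 0 "R + 2"]) auto
    have diff_supp: "AE x in lborel. x \<notin> cball 0 (R + 2) \<longrightarrow> h x - \<psi> x = 0"
      using bound by eventually_elim (auto simp: supp split: split_indicator_asm)
    have bd: "\<bar>\<integral>x. u x * (h x - \<psi> x) \<partial>lborel\<bar> \<le> C * e' \<and> integrable lborel (\<lambda>x. u x * h x)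
        \<and> integrable lborel (\<lambda>x. u x * \<psi> x)"
      if [measurable]: "u \<in> borel_measurable borel" and C: "C \<ge> 0"
        and u: "AE x in lborel. x \<in> cball 0 (R + 2) \<longrightarrow> \<bar>u x\<bar> \<le> C" for u C
    proof (intro conjI)
      have "\<bar>\<integral>x. u x * (h x - \<psi> x) \<partial>lborel\<bar> \<le> (\<integral>x. C * \<bar>h x - \<psi> x\<bar> \<partial>lborel)"
      proof (rule abs_integral_le)
        show "AE x in lborel. \<bar>u x * (h x - \<psi> x)\<bar> \<le> C * \<bar>h x - \<psi> x\<bar>"
          using u diff_supp
        proof eventually_elim
          case (elim x)
          then show ?case
            using C by (cases "x \<in> cball 0 (R + 2)") (auto simp: abs_mult intro: mult_right_mono)
        qed
      qed (use int_h int_\<psi> in auto)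
      also have "\<dots> \<le> C * e'" using close C by (simp add: mult_left_mono)
      finally show "\<bar>\<integral>x. u x * (h x - \<psi> x) \<partial>lborel\<bar> \<le> C * e'" .
      show "integrable lborel (\<lambda>x. u x * h x)"
      proof (rule Bochner_Integration.integrable_bound)
        show "integrable lborel (\<lambda>x. C * \<bar>h x\<bar>)" using int_h by simp
        show "AE x in lborel. norm (u x * h x) \<le> norm (C * \<bar>h x\<bar>)"
          using u bound
        proof eventually_elim
          case (elim x)
          then show ?case
            using C by (cases "x \<in> cball 0 R") (auto simp: abs_mult intro!: mult_right_mono)
        qed
      qed measurable
      show "integrable lborel (\<lambda>x. u x * \<psi> x)"
      proof (rule Bochner_Integration.integrable_bound)
        show "integrable lborel (\<lambda>x. C * \<bar>\<psi> x\<bar>)" using int_\<psi> by simp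
        show "AE x in lborel. norm (u x * \<psi> x) \<le> norm (C * \<bar>\<psi> x\<bar>)"
          using u
        proof eventually_elim
          case (elim x)
          then show ?case
            using C supp by (cases "x \<in> cball 0 (R + 2)") (auto simp: abs_mult intro!: mult_right_mono)
        qed
      qed measurable
    qed
    have bd_a: "\<bar>\<integral>x. ?a n x * (h x - \<psi> x) \<partial>lborel\<bar> \<le> B1 * e' \<and> integrable lborel (\<lambda>x. ?a n x * h x)
        \<and> integrable lborel (\<lambda>x. ?a n x * \<psi> x)" for n
    proof (rule bd)
      show "AE x in lborel. x \<in> cball 0 (R + 2) \<longrightarrow> \<bar>?a n x\<bar> \<le> B1"
        by (intro AE_I2 impI B1) auto
    qed (use B1 in measurable)
    have bd_g: "\<bar>\<integral>x. g x * (h x - \<psi> x) \<partial>lborel\<bar> \<le> B2 * e' \<and> integrable lborel (\<lambda>x. g x * h x)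
        \<and> integrable lborel (\<lambda>x. g x * \<psi> x)"
      using B2 by (intro bd) auto
    obtain A where A: "A \<ge> 0" "\<And>N x. N \<ge> 1 \<Longrightarrow> x \<in> cball 0 (R + 2) \<Longrightarrow> \<bar>mollify N f x\<bar> \<le> A"
      using mollify_bounded[OF f, of "R + 2"] by blast
    have lie_\<psi>: "C_infinity (lie V \<psi>)" by (rule C_infinity_lie[OF V \<psi>])
    have lie_supp: "norm x > R + 2 \<Longrightarrow> lie V \<psi> x = 0" for x
      by (rule lie_support[OF supp])
    have "(\<lambda>n. \<integral>x. mollify (real (Suc n)) f x * lie V \<psi> x \<partial>lborel)
        \<longlonglongrightarrow> (\<integral>x. f x * lie V \<psi> x \<partial>lborel)"
    proof (rule integral_dominated_convergence)
      show "integrable lborel (\<lambda>x. A * \<bar>lie V \<psi> x\<bar>)"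
        using C_infinity_continuous[OF lie_\<psi>] lie_supp
        by (intro integrable_mult_right integrable_abs integrable_continuous_support[of _ 0 "R + 2"]) auto
      show "AE x in lborel. (\<lambda>n. mollify (real (Suc n)) f x * lie V \<psi> x) \<longlonglongrightarrow> f x * lie V \<psi> x"
        by (intro AE_I2 tendsto_intros mollify_tendsto f)
      show "AE x in lborel. norm (mollify (real (Suc n)) f x * lie V \<psi> x) \<le> A * \<bar>lie V \<psi> x\<bar>" for n
      proof (rule AE_I2)
        fix x
        show "norm (mollify (real (Suc n)) f x * lie V \<psi> x) \<le> A * \<bar>lie V \<psi> x\<bar>"
          using A(2)[of "real (Suc n)" x] lie_supp[of x]
          by (cases "norm x > R + 2") (auto simp: abs_mult intro: mult_right_mono)
      qed
      show "(\<lambda>x. mollify (real (Suc n)) f x * lie V \<psi> x) \<in> borel_measurable lborel" for n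
        using C_infinity_measurable[OF lie_\<psi>]
          C_infinity_measurable[OF C_infinity_mollify[OF f, of "real (Suc n)"]]
        by measurable
      show "(\<lambda>x. f x * lie V \<psi> x) \<in> borel_measurable lborel"
        using C_infinity_measurable[OF lie_\<psi>] borel_measurable_continuous_onI[OF f] by measurable
    qed
    then have "(\<lambda>n. - (\<integral>x. mollify (real (Suc n)) f x * lie V \<psi> x \<partial>lborel))
        \<longlonglongrightarrow> - (\<integral>x. f x * lie V \<psi> x \<partial>lborel)"
      by (rule tendsto_minus)
    \<comment> \<open>Both integrals are rewritten with the derivative on \<open>\<psi>\<close>: by
      classical integration by parts for the mollification and by the definition of the weak
      derivative for \<open>g\<close>. Only pointwise convergence of the mollifications remains,
      which was settled by domination.\<close>
    then have lim_\<psi>: "(\<lambda>n. \<integral>x. ?a n x * \<psi> x \<partial>lborel) \<longlonglongrightarrow> (\<integral>x. g x * \<psi> x \<partial>lborel)"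
      using integral_lie_by_parts[OF V C_infinity_mollify[OF f] \<psi> supp] is_weak_derivD[OF w V \<psi> supp]
      by simp
    have "e / 2 > 0" using e by simp
    from LIMSEQ_D[OF lim_\<psi> this] obtain n0 where
      n0: "\<And>n. n \<ge> n0 \<Longrightarrow> \<bar>(\<integral>x. ?a n x * \<psi> x \<partial>lborel) - (\<integral>x. g x * \<psi> x \<partial>lborel)\<bar> < e / 2"
      unfolding real_norm_def by blast
    have "norm ((\<integral>x. ?a n x * h x \<partial>lborel) - (\<integral>x. g x * h x \<partial>lborel)) < e" if "n \<ge> n0" for n
    proof -
      have "(\<integral>x. ?a n x * (h x - \<psi> x) \<partial>lborel) = (\<integral>x. ?a n x * h x \<partial>lborel) - (\<integral>x. ?a n x * \<psi> x \<partial>lborel)"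
        using bd_a[of n] by (simp add: right_diff_distrib)
      moreover have "(\<integral>x. g x * (h x - \<psi> x) \<partial>lborel) = (\<integral>x. g x * h x \<partial>lborel) - (\<integral>x. g x * \<psi> x \<partial>lborel)"
        using bd_g by (simp add: right_diff_distrib)
      moreover have "B1 * e' + B2 * e' \<le> e / 2" using e'(2) by (simp add: distrib_right)
      ultimately show ?thesis
        using bd_a[of n] bd_g n0[OF that] by (simp only: real_norm_def) linarith
    qed
    then show "\<exists>n0. \<forall>n\<ge>n0. norm ((\<integral>x. ?a n x * h x \<partial>lborel) - (\<integral>x. g x * h x \<partial>lborel)) < e"
      by blast
  qed
qed

text \<open>A bounded weak-star convergent factor tolerates a second factor that converges boundedly
  almost everywhere: the error \<open>hs n - h\<close> is absorbed by dominated convergence, and the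
  fixed factor \<open>h\<close> is the previous lemma.\<close>

lemma weak_star_mollify_strong:
  fixes f h :: "real^'n::finite \<Rightarrow> real" and hs :: "nat \<Rightarrow> real^'n \<Rightarrow> real"
  assumes f: "continuous_on UNIV f" and V: "smooth_div_free V" and w: "is_weak_deriv V f g"
    and h[measurable]: "h \<in> borel_measurable borel"
    and hs[measurable]: "\<And>n. hs n \<in> borel_measurable borel"
    and bound: "\<And>n. AE x in lborel. \<bar>hs n x\<bar> \<le> M * indicator (cball 0 R) x"
    and lim: "AE x in lborel. (\<lambda>n. hs n x) \<longlonglongrightarrow> h x"
  shows "(\<lambda>n. \<integral>x. lie V (mollify (real (Suc n)) f) x * hs n x \<partial>lborel) \<longlonglongrightarrow> (\<integral>x. g x * h x \<partial>lborel)"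
proof -
  let ?a = "\<lambda>n. lie V (mollify (real (Suc n)) f)"
  have a_smooth: "C_infinity (?a n)" for n
    by (intro C_infinity_lie V C_infinity_mollify f) simp
  note [measurable] = C_infinity_measurable[OF a_smooth]
  have "AE x in lborel. \<forall>n. \<bar>hs n x\<bar> \<le> M * indicator (cball 0 R) x"
    using bound by (simp add: AE_all_countable)
  with lim have bound_h: "AE x in lborel. \<bar>h x\<bar> \<le> M * indicator (cball 0 R) x"
  proof eventually_elim
    case (elim x)
    have "(\<lambda>n. \<bar>hs n x\<bar>) \<longlonglongrightarrow> \<bar>h x\<bar>" by (intro tendsto_intros elim)
    then show ?case by (rule LIMSEQ_le_const2) (use elim in auto)
  qed
  obtain B where B: "B \<ge> 0" "\<And>N x. N \<ge> 1 \<Longrightarrow> x \<in> cball 0 R \<Longrightarrow> \<bar>lie V (mollify N f) x\<bar> \<le> B"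
    using lie_mollify_bounded[OF f V w, of R] by blast
  have ind: "integrable lborel (\<lambda>x. C * indicator (cball (0::real^'n) R) x)" for C :: real
    using emeasure_lborel_cball_finite[of "0::real^'n" R]
    by (intro integrable_mult_right integrable_real_indicator) auto
  have prod_bound: "AE x in lborel. \<bar>?a n x * u x\<bar> \<le> B * M * indicator (cball 0 R) x"
    if "AE x in lborel. \<bar>u x\<bar> \<le> M * indicator (cball 0 R) x" for u n
    using that
  proof eventually_elim
    case (elim x)
    then show ?case
      using B(1) B(2)[of "real (Suc n)" x]
      by (cases "x \<in> cball 0 R") (auto simp: abs_mult intro: mult_mono)
  qed
  have "(\<lambda>n. \<integral>x. ?a n x * (hs n x - h x) \<partial>lborel) \<longlonglongrightarrow> (\<integral>x. 0 \<partial>(lborel :: (real^'n) measure))"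
  proof (rule integral_dominated_convergence)
    show "integrable lborel (\<lambda>x. 2 * (B * M) * indicator (cball (0::real^'n) R) x)"
      by (rule ind)
    show "AE x in lborel. norm (?a n x * (hs n x - h x)) \<le> 2 * (B * M) * indicator (cball 0 R) x" for n
      using prod_bound[OF bound, of n n] prod_bound[OF bound_h, of n]
    proof eventually_elim
      case (elim x)
      then show ?case using abs_triangle_ineq4[of "?a n x * hs n x" "?a n x * h x"]
        by (simp add: right_diff_distrib)
    qed
    show "AE x in lborel. (\<lambda>n. ?a n x * (hs n x - h x)) \<longlonglongrightarrow> 0"
      using lim bound_h \<open>AE x in lborel. \<forall>n. \<bar>hs n x\<bar> \<le> M * indicator (cball 0 R) x\<close>
    proof eventually_elim
      case (elim x)
      have "(\<lambda>n. B * \<bar>hs n x - h x\<bar>) \<longlonglongrightarrow> B * \<bar>h x - h x\<bar>" by (intro tendsto_intros elim)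
      then have l0: "(\<lambda>n. B * \<bar>hs n x - h x\<bar>) \<longlonglongrightarrow> 0" by simp
      have "norm (?a n x * (hs n x - h x)) \<le> B * \<bar>hs n x - h x\<bar>" for n
      proof (cases "x \<in> cball 0 R")
        case True
        then show ?thesis using B(2)[of "real (Suc n)" x] by (auto simp: abs_mult intro: mult_right_mono)
      next
        case False
        then have "hs n x = 0" "h x = 0" using elim by auto
        then show ?thesis by simp
      qed
      then show ?case by (intro Lim_null_comparison[OF _ l0]) auto
    qed
  qed measurable
  then have 1: "(\<lambda>n. \<integral>x. ?a n x * (hs n x - h x) \<partial>lborel) \<longlonglongrightarrow> 0" by simp
  have int: "integrable lborel (\<lambda>x. ?a n x * u x)"
    if [measurable]: "u \<in> borel_measurable borel"
      and "AE x in lborel. \<bar>u x\<bar> \<le> M * indicator (cball 0 R) x" for u n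
    by (rule integrable_bounded_support[OF _ prod_bound[OF that(2)]]) measurable
  have "(\<integral>x. ?a n x * (hs n x - h x) \<partial>lborel) + (\<integral>x. ?a n x * h x \<partial>lborel)
      = (\<integral>x. ?a n x * hs n x \<partial>lborel)" for n
    using int[OF h bound_h, of n] int[OF hs bound, of n n] by (simp add: right_diff_distrib)
  moreover have "(\<lambda>n. (\<integral>x. ?a n x * (hs n x - h x) \<partial>lborel) + (\<integral>x. ?a n x * h x \<partial>lborel))
      \<longlonglongrightarrow> 0 + (\<integral>x. g x * h x \<partial>lborel)"
    by (intro tendsto_add 1 weak_star_mollify[OF f V w h bound_h])
  ultimately show ?thesis by simp
qed

subsection \<open>The tested inequality\<close>

text \<open>Of the two derivatives in each square, one moves to \<open>\<Phi>\<close> and the other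
  is absorbed by the weak derivative \<open>g i\<close> of \<open>d\<close>. Hence no second
  derivative appears, neither of \<open>d\<close> nor of \<open>\<Phi>\<close>.\<close>

lemma laplacian_tested_with_mollification:
  fixes X :: "nat \<Rightarrow> real^'n::finite \<Rightarrow> real^'n" and g :: "nat \<Rightarrow> real^'n \<Rightarrow> real"
  assumes V: "\<And>i. i \<in> {1..k} \<Longrightarrow> smooth_div_free (X i)"
    and g: "\<And>i. i \<in> {1..k} \<Longrightarrow> is_weak_deriv (X i) d (g i)"
    and \<Phi>: "C_infinity \<Phi>" and S: "compact S" "S \<subseteq> {x. d x > 0}" "\<And>x. x \<notin> S \<Longrightarrow> \<Phi> x = 0"
    and nonneg: "\<And>x. \<Phi> x \<ge> 0"
    and lap: "distr_le_on {x. d x > 0}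
      (\<lambda>\<phi>. a * regular_distr H \<phi> + a * distr_laplacian X k (regular_distr d) \<phi>) (regular_distr Q)"
  shows "a * (\<integral>x. H x * \<Phi> x \<partial>lborel) - a * (\<Sum>i=1..k. \<integral>x. g i x * lie (X i) \<Phi> x \<partial>lborel)
    \<le> (\<integral>x. Q x * \<Phi> x \<partial>lborel)"
proof -
  have \<Phi>_test: "\<Phi> \<in> test_functions {x. d x > 0}"
    by (rule test_functionsI[OF \<Phi> S])
  obtain r where r: "\<forall>x\<in>S. norm x \<le> r"
    using compact_imp_bounded[OF S(1)] unfolding bounded_iff by blast
  have supp: "\<Phi> z = 0" if "norm z > r" for z
    using r that by (intro S(3)) auto
  have "distr_deriv (X i) (distr_deriv (X i) (regular_distr d)) \<Phi>
      = - (\<integral>x. g i x * lie (X i) \<Phi> x \<partial>lborel)" if i: "i \<in> {1..k}" for i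
  proof -
    have "(\<lambda>x. - lie (X i) \<Phi> x) \<in> test_functions UNIV"
      using lie_support[of r \<Phi>, OF supp]
      by (intro test_functionsI_cball[of _ r] C_infinity_uminus C_infinity_lie V i \<Phi>) auto
    then have "distr_deriv (X i) (regular_distr d) (\<lambda>x. - lie (X i) \<Phi> x)
        = regular_distr (g i) (\<lambda>x. - lie (X i) \<Phi> x)"
      using g[OF i] by (simp add: is_weak_deriv_def distr_eq_on_def)
    then show ?thesis
      by (simp add: distr_deriv_def[of "X i" "distr_deriv (X i) (regular_distr d)"]
          formal_adjoint_eq_lie[OF V[OF i] \<Phi>] regular_distr_def)
  qed
  then have "distr_laplacian X k (regular_distr d) \<Phi> = - (\<Sum>i=1..k. \<integral>x. g i x * lie (X i) \<Phi> x \<partial>lborel)"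
    by (simp add: distr_laplacian_def sum_negf)
  moreover have "a * regular_distr H \<Phi> + a * distr_laplacian X k (regular_distr d) \<Phi> \<le> regular_distr Q \<Phi>"
    using lap \<Phi>_test nonneg unfolding distr_le_on_def by blast
  ultimately show ?thesis by (simp add: regular_distr_def)
qed

text \<open>The limit passage for the test function \<open>(f x)\<^sup>2 * G (d x)\<close>;
  \<open>J\<close> is the difference of the two sides of the tested inequality after expanding the
  derivative of that function. The support of \<open>G\<close> keeps all integrands away from the
  zeros of \<open>d\<close> and, by compactness of the balls, bounded in space. Smoothness of
  compositions with \<open>G\<close> is asked only for positive functions, because powers occur in
  it.\<close>

lemma laplacian_tested_with_class_L:
  fixes X :: "nat \<Rightarrow> real^'n::finite \<Rightarrow> real^'n" and d f Q :: "real^'n \<Rightarrow> real"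
    and g u :: "nat \<Rightarrow> real^'n \<Rightarrow> real" and G G' :: "real \<Rightarrow> real"
  assumes V: "\<And>i. i \<in> {1..k} \<Longrightarrow> smooth_div_free (X i)"
    and g: "\<And>i. i \<in> {1..k} \<Longrightarrow> is_weak_deriv (X i) d (g i)"
    and u: "\<And>i. i \<in> {1..k} \<Longrightarrow> is_weak_deriv (X i) f (u i)"
    and d: "continuous_on UNIV d" "\<And>x. d x \<ge> 0" "\<And>R. compact {x. d x \<le> R}"
    and f: "continuous_on UNIV f" and Q: "continuous_on UNIV Q"
    and lap: "distr_le_on {x. d x > 0}
      (\<lambda>\<phi>. a * regular_distr (\<lambda>x. (\<Sum>i=1..k. (g i x)\<^sup>2) / d x) \<phi>
        + a * distr_laplacian X k (regular_distr d) \<phi>) (regular_distr (\<lambda>x. Q x / d x))"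
    and G_smooth: "\<And>h. C_infinity h \<Longrightarrow> (\<And>x::real^'n. h x > 0) \<Longrightarrow> C_infinity (\<lambda>x. G (h x))"
    and G_deriv: "\<And>t. t > 0 \<Longrightarrow> (G has_field_derivative G' t) (at t)"
    and G'_cont: "\<And>t. t > 0 \<Longrightarrow> isCont G' t"
    and G_nonneg: "\<And>t. G t \<ge> 0"
    and G_supp: "\<And>t. t \<notin> {1/2..T} \<Longrightarrow> G t = 0 \<and> G' t = 0"
    and J_def: "J = (\<lambda>x. a * ((\<Sum>i=1..k. (g i x)\<^sup>2) / d x * ((f x)\<^sup>2 * G (d x)))
      - a * (\<Sum>i=1..k. u i x * (2 * g i x * f x * G (d x)) + g i x * (g i x * (f x)\<^sup>2 * G' (d x)))
      - Q x / d x * ((f x)\<^sup>2 * G (d x)))"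
  shows "integrable lborel J" and "(\<integral>x. J x \<partial>lborel) \<le> 0"
proof -
  define N where "N n = real (Suc n)" for n
  have N1: "N n \<ge> 1" for n by (simp add: N_def)
  then have N0: "N n > 0" for n using less_le_trans[OF zero_less_one] by blast
  define m where "m n = mollify (N n) d" for n
  \<comment> \<open>The mollification of \<open>d\<close> is only known to be nonnegative here; the
    shift makes it strictly positive, so that composition with \<open>G\<close> is smooth. It
    vanishes in the limit and does not affect derivatives.\<close>
  define D where "D n x = m n x + 1 / N n" for n x
  define F where "F n = mollify (N n) f" for n
  define \<Phi> where "\<Phi> n x = F n x * F n x * G (D n x)" for n x
  have m_smooth: "C_infinity (m n)" for n
    unfolding m_def by (rule C_infinity_mollify[OF d(1) N0])
  have D_smooth: "C_infinity (D n)" for n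
    unfolding D_def[abs_def] by (intro C_infinity_add C_infinity_const m_smooth)
  have F_smooth: "C_infinity (F n)" for n
    unfolding F_def by (rule C_infinity_mollify[OF f N0])
  have D_pos: "D n x > 0" for n x
  proof -
    have "m n x \<ge> 0" unfolding m_def by (rule mollify_ge[OF d(1) N0 d(2)])
    then show ?thesis using N0[of n] by (simp add: D_def add_nonneg_pos)
  qed
  have GD_smooth: "C_infinity (\<lambda>x. G (D n x))" for n
    by (rule G_smooth[OF D_smooth D_pos])
  have \<Phi>_smooth: "C_infinity (\<Phi> n)" for n
    unfolding \<Phi>_def[abs_def] by (intro C_infinity_mult F_smooth GD_smooth)
  have \<Phi>_nonneg: "\<Phi> n x \<ge> 0" for n x
    using G_nonneg by (simp add: \<Phi>_def)

  obtain R1 where "\<forall>x\<in>{x. d x \<le> T}. norm x \<le> R1"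
    using compact_imp_bounded[OF d(3)] unfolding bounded_iff by blast
  then have R1: "d x > T" if "norm x > R1" for x
    using that by (auto simp: not_le[symmetric])
  \<comment> \<open>The extra 1 covers the averaging radius: beyond \<open>R\<close> the
    mollification only sees points with \<open>d\<close> above \<open>T\<close>.\<close>
  define R where "R = R1 + 1"
  have far: "d x > T" "D n x > T" if x: "norm x > R" for n x
  proof -
    show "d x > T" using R1[of x] x by (simp add: R_def)
    have "T \<le> m n x"
      unfolding m_def
    proof (rule mollify_ge[OF d(1) N0])
      fix y assume "y \<in> cball x (1 / N n)"
      then have "norm (x - y) \<le> 1 / N n" by (simp add: dist_norm)
      also have "1 / N n \<le> 1" using N1[of n] by simp
      finally have "norm y > R1" using x norm_triangle_sub[of x y] by (simp add: R_def)
      then show "T \<le> d y" using R1[of y] by simp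
    qed
    moreover have "1 / N n > 0" using N0[of n] by simp
    ultimately show "D n x > T" unfolding D_def by linarith
  qed
  have G_far: "G (d x) = 0" "G' (d x) = 0" "G (D n x) = 0" "G' (D n x) = 0" if "norm x > R" for n x
    using far[OF that] G_supp by (auto simp: not_le)

  have G_cont: "isCont G t" if "t > 0" for t using G_deriv[OF that] by (rule DERIV_isCont)
  have bounded_supp: "\<exists>C. \<forall>t. \<bar>h t\<bar> \<le> C"
    if h: "\<And>t. t > 0 \<Longrightarrow> isCont h t" and supp: "\<And>t. t \<notin> {1/2..T} \<Longrightarrow> h t = 0" for h :: "real \<Rightarrow> real"
  proof -
    have "continuous_on {1/2..T} h" using h by (intro continuous_at_imp_continuous_on) auto
    then have "bounded (h ` {1/2..T})"
      by (intro compact_imp_bounded compact_continuous_image compact_Icc)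
    then obtain C where C: "C > 0" "\<forall>t\<in>{1/2..T}. \<bar>h t\<bar> \<le> C" by (auto simp: bounded_pos)
    have "\<bar>h t\<bar> \<le> C" for t using C supp[of t] by (cases "t \<in> {1/2..T}") auto
    then show ?thesis by blast
  qed
  obtain C1 where C1: "\<And>t. \<bar>G t\<bar> \<le> C1"
    using bounded_supp[OF G_cont conjunct1[OF G_supp]] by auto
  obtain C2 where C2: "\<And>t. \<bar>G' t\<bar> \<le> C2"
    using bounded_supp[OF G'_cont conjunct2[OF G_supp]] by auto
  define C where "C = max C1 C2"
  have C: "\<bar>G t\<bar> \<le> C" "\<bar>G' t\<bar> \<le> C" for t
    using C1[of t] C2[of t] by (auto simp: C_def)
  have C0: "C \<ge> 0" using C(1)[of 0] by linarith

  have D_lim: "(\<lambda>n. D n x) \<longlonglongrightarrow> d x" for x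
  proof -
    have "(\<lambda>n. D n x) \<longlonglongrightarrow> d x + 0"
      unfolding D_def m_def N_def
      by (intro tendsto_add mollify_tendsto d(1)) (rule LIMSEQ_inverse_real_of_nat[unfolded inverse_eq_divide])
    then show ?thesis by simp
  qed
  have F_lim: "(\<lambda>n. F n x) \<longlonglongrightarrow> f x" for x
    unfolding F_def N_def by (rule mollify_tendsto[OF f])
  have comp_lim: "(\<lambda>n. h (D n x)) \<longlonglongrightarrow> h (d x)"
    if h: "\<And>t. t > 0 \<Longrightarrow> isCont h t" and supp: "\<And>t. t \<notin> {1/2..T} \<Longrightarrow> h t = 0" for h :: "real \<Rightarrow> real" and x
  proof (cases "d x > 0")
    case True
    then show ?thesis by (rule isCont_tendsto_compose[OF h D_lim])
  next
    case False
    \<comment> \<open>Continuity of \<open>h\<close> at 0 is not assumed. Instead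
      \<open>D n x\<close> eventually lies below 1/2, outside the support, so the sequence is
      eventually equal to its limit 0.\<close>
    then have d0: "d x = 0" using d(2)[of x] by simp
    have "\<forall>\<^sub>F n in sequentially. D n x < 1/2"
      using D_lim[of x] d0 by (intro order_tendstoD(2)[of _ 0]) auto
    then have "\<forall>\<^sub>F n in sequentially. h (D n x) = h (d x)"
      by eventually_elim (use supp d0 in auto)
    then show ?thesis by (rule tendsto_eventually)
  qed
  have G_lim: "(\<lambda>n. G (D n x)) \<longlonglongrightarrow> G (d x)" and G'_lim: "(\<lambda>n. G' (D n x)) \<longlonglongrightarrow> G' (d x)" for x
    by (rule comp_lim[OF G_cont conjunct1[OF G_supp]] comp_lim[OF G'_cont conjunct2[OF G_supp]]; assumption)+

  obtain A where A: "A \<ge> 0" "\<And>n x. x \<in> cball 0 R \<Longrightarrow> \<bar>F n x\<bar> \<le> A"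
    using mollify_bounded[OF f, of R] N1 unfolding F_def by blast
  have [measurable]: "d \<in> borel_measurable borel" "f \<in> borel_measurable borel" "Q \<in> borel_measurable borel"
    using d f Q by (auto intro: borel_measurable_continuous_onI)
  note [measurable] = C_infinity_measurable[OF F_smooth] C_infinity_measurable[OF D_smooth]
    C_infinity_measurable[OF GD_smooth] C_infinity_measurable[OF \<Phi>_smooth]
  have [measurable]: "(\<lambda>x. G (d x)) \<in> borel_measurable borel"
    by (rule borel_measurable_LIMSEQ_metric[OF _ G_lim]) measurable
  have G'D[measurable]: "(\<lambda>x. G' (D n x)) \<in> borel_measurable borel" for n
  proof -
    have "continuous_on UNIV (\<lambda>x. G' (D n x))"
      using G'_cont[OF D_pos] C_infinity_continuous[OF D_smooth[of n]]
      by (auto simp: continuous_on_eq_continuous_at intro: continuous_within_compose3)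
    then show ?thesis by (rule borel_measurable_continuous_onI)
  qed
  have [measurable]: "(\<lambda>x. G' (d x)) \<in> borel_measurable borel"
    by (rule borel_measurable_LIMSEQ_metric[OF _ G'_lim]) measurable
  have g_meas: "g i \<in> borel_measurable borel" if "i \<in> {1..k}" for i
    by (rule is_weak_deriv_measurable[OF g[OF that]])
  have u_meas: "u i \<in> borel_measurable borel" if "i \<in> {1..k}" for i
    by (rule is_weak_deriv_measurable[OF u[OF that]])

  have "\<forall>\<^sub>F n in sequentially. \<forall>x. \<Phi> n x \<noteq> 0 \<longrightarrow> x \<in> cball 0 R \<and> d x \<ge> 1/4"
  proof -
    \<comment> \<open>On the support of \<open>G\<close> the argument \<open>D n x\<close> is at
      least 1/2. The mollification error and the shift cost at most 1/8 each, which leaves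
      \<open>d x\<close> at least 1/4. This makes \<open>\<Phi> n\<close> an admissible test
      function on the set where \<open>d\<close> is positive and bounds 1/d by 4.\<close>
    obtain N' where N': "\<forall>M\<ge>N'. \<forall>x\<in>cball 0 R. \<bar>mollify M d x - d x\<bar> \<le> 1/8"
      using mollify_uniform[OF d(1), of "1/8" R] by auto
    obtain n0 where n0: "real n0 \<ge> max 8 N'" using real_arch_simple by blast
    show ?thesis
      unfolding eventually_sequentially
    proof (intro exI[of _ n0] allI impI)
      fix n x assume n: "n \<ge> n0" and nz: "\<Phi> n x \<noteq> 0"
      have Nn: "N n \<ge> 8" "N n \<ge> N'" using n n0 by (auto simp: N_def)
      have x: "x \<in> cball 0 R" using nz G_far(3)[of x n] by (force simp: \<Phi>_def)
      have "D n x \<ge> 1/2" using nz G_supp[of "D n x"] by (force simp: \<Phi>_def)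
      moreover have "1 / N n \<le> 1/8" using Nn(1) by (simp add: field_simps)
      moreover have "\<bar>m n x - d x\<bar> \<le> 1/8" using N' Nn(2) x unfolding m_def by blast
      ultimately have "d x \<ge> 1/4" unfolding D_def abs_le_iff by linarith
      with x show "x \<in> cball 0 R \<and> d x \<ge> 1/4" by blast
    qed
  qed
  then obtain n0 where n0: "\<And>n x. n \<ge> n0 \<Longrightarrow> \<Phi> n x \<noteq> 0 \<Longrightarrow> x \<in> cball 0 R \<and> d x \<ge> 1/4"
    by (auto simp: eventually_sequentially)

  have \<Phi>_lim: "(\<lambda>n. \<Phi> n x) \<longlonglongrightarrow> (f x)\<^sup>2 * G (d x)" for x
    unfolding \<Phi>_def power2_eq_square by (intro tendsto_mult F_lim G_lim)
  have \<Phi>_bound: "\<bar>\<Phi> n x\<bar> \<le> A * A * C" if "x \<in> cball 0 R" for n x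
    unfolding \<Phi>_def abs_mult using A C by (intro mult_mono mult_nonneg_nonneg A that) auto
  have dct: "integrable lborel (\<lambda>x. W x / d x * ((f x)\<^sup>2 * G (d x)))
      \<and> (\<lambda>n. \<integral>x. W x / d x * \<Phi> n x \<partial>lborel) \<longlonglongrightarrow> (\<integral>x. W x / d x * ((f x)\<^sup>2 * G (d x)) \<partial>lborel)"
    if [measurable]: "W \<in> borel_measurable borel" and B: "B \<ge> 0"
      and W: "AE x in lborel. x \<in> cball 0 R \<longrightarrow> \<bar>W x\<bar> \<le> B" for W B
  proof -
    \<comment> \<open>The index is shifted by \<open>n0\<close> because the domination of 1/d is
      known only from there on; the limit is unaffected.\<close>
    have b: "AE x in lborel. norm (W x / d x * \<Phi> (n + n0) x) \<le> 4 * B * (A * A * C) * indicator (cball 0 R) x" for n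
      using W
    proof eventually_elim
      case (elim x)
      show ?case
      proof (cases "\<Phi> (n + n0) x = 0")
        case True
        then show ?thesis using A B C0 by simp
      next
        case False
        then have x: "x \<in> cball 0 R" "d x \<ge> 1/4" using n0[of "n + n0" x] by auto
        have "\<bar>W x\<bar> / d x \<le> B / (1/4)"
          using elim x B by (intro frac_le) auto
        then have "\<bar>W x / d x\<bar> \<le> 4 * B" using x by simp
        then have "\<bar>W x / d x\<bar> * \<bar>\<Phi> (n + n0) x\<bar> \<le> 4 * B * (A * A * C)"
          using \<Phi>_bound[OF x(1)] B by (intro mult_mono) auto
        then show ?thesis using x(1) by (simp add: abs_mult)
      qed
    qed
    have l: "AE x in lborel. (\<lambda>n. W x / d x * \<Phi> (n + n0) x) \<longlonglongrightarrow> W x / d x * ((f x)\<^sup>2 * G (d x))"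
      by (intro AE_I2 tendsto_mult tendsto_const LIMSEQ_ignore_initial_segment \<Phi>_lim)
    have i: "integrable lborel (\<lambda>x. 4 * B * (A * A * C) * indicator (cball (0::real^'n) R) x)"
      using emeasure_lborel_cball_finite[of "0::real^'n" R]
      by (intro integrable_mult_right integrable_real_indicator) auto
    have "integrable lborel (\<lambda>x. W x / d x * ((f x)\<^sup>2 * G (d x)))"
      by (rule integrable_dominated_convergence[OF _ _ i l b]) measurable
    moreover have "(\<lambda>n. \<integral>x. W x / d x * \<Phi> (n + n0) x \<partial>lborel)
        \<longlonglongrightarrow> (\<integral>x. W x / d x * ((f x)\<^sup>2 * G (d x)) \<partial>lborel)"
      by (rule integral_dominated_convergence[OF _ _ i l b]) measurable
    ultimately show ?thesis by (blast intro: LIMSEQ_offset)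
  qed

  \<comment> \<open>The product and chain rules give two terms, each linear in a single mollified
    derivative and otherwise built from pointwise convergent factors.\<close>
  have lie_\<Phi>: "lie (X i) (\<Phi> n) x = lie (X i) (F n) x * (2 * F n x * G (D n x))
      + lie (X i) (m n) x * ((F n x)\<^sup>2 * G' (D n x))" for i n x
  proof -
    have "((\<lambda>t. t + 1 / N n) has_field_derivative 1) (at (m n x))"
      by (auto intro!: derivative_eq_intros)
    from lie_compose[OF m_smooth this, of "X i"]
    have "lie (X i) (D n) x = lie (X i) (m n) x"
      by (simp add: D_def[abs_def])
    then have "lie (X i) (\<lambda>x. G (D n x)) x = G' (D n x) * lie (X i) (m n) x"
      using lie_compose[OF D_smooth G_deriv[OF D_pos], of "X i" n x] by simp
    then show ?thesis
      unfolding \<Phi>_def[abs_def]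
      by (simp add: lie_mult C_infinity_mult F_smooth GD_smooth power2_eq_square algebra_simps)
  qed

  have lim_i: "integrable lborel (\<lambda>x. u i x * (2 * g i x * f x * G (d x)))
      \<and> integrable lborel (\<lambda>x. g i x * (g i x * (f x)\<^sup>2 * G' (d x)))
      \<and> (\<lambda>n. \<integral>x. g i x * lie (X i) (\<Phi> n) x \<partial>lborel)
        \<longlonglongrightarrow> (\<integral>x. u i x * (2 * g i x * f x * G (d x)) \<partial>lborel)
          + (\<integral>x. g i x * (g i x * (f x)\<^sup>2 * G' (d x)) \<partial>lborel)" if i: "i \<in> {1..k}" for i
  proof -
    note [measurable] = g_meas[OF i] u_meas[OF i]
    obtain B where B: "B \<ge> 0" "AE x in lborel. x \<in> cball 0 R \<longrightarrow> \<bar>g i x\<bar> \<le> B"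
      using is_weak_deriv_bounded[OF g[OF i]] by blast
    obtain B' where B': "B' \<ge> 0" "AE x in lborel. x \<in> cball 0 R \<longrightarrow> \<bar>u i x\<bar> \<le> B'"
      using is_weak_deriv_bounded[OF u[OF i]] by blast
    \<comment> \<open>The fixed function \<open>g i\<close> is grouped with the pointwise convergent
      factors, so that the derivative of the mollification is the only factor converging merely
      weak-star.\<close>
    let ?h1 = "\<lambda>n x. g i x * (2 * F n x * G (D n x))"
    let ?h2 = "\<lambda>n x. g i x * ((F n x)\<^sup>2 * G' (D n x))"
    have b1: "AE x in lborel. \<bar>?h1 n x\<bar> \<le> B * (2 * A * C) * indicator (cball 0 R) x" for n
      using B(2)
    proof eventually_elim
      case (elim x)
      show ?case
      proof (cases "x \<in> cball 0 R")
        case True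
        have "\<bar>g i x\<bar> * (2 * \<bar>F n x\<bar> * \<bar>G (D n x)\<bar>) \<le> B * (2 * A * C)"
          using elim True A B C C0 by (intro mult_mono mult_nonneg_nonneg) auto
        then show ?thesis using True by (simp add: abs_mult)
      qed (use G_far in auto)
    qed
    have b2: "AE x in lborel. \<bar>?h2 n x\<bar> \<le> B * (A\<^sup>2 * C) * indicator (cball 0 R) x" for n
      using B(2)
    proof eventually_elim
      case (elim x)
      show ?case
      proof (cases "x \<in> cball 0 R")
        case True
        have "\<bar>F n x\<bar>\<^sup>2 \<le> A\<^sup>2" using A True by (intro power_mono) auto
        then have "\<bar>g i x\<bar> * ((F n x)\<^sup>2 * \<bar>G' (D n x)\<bar>) \<le> B * (A\<^sup>2 * C)"
          using elim True A B C C0 by (intro mult_mono mult_nonneg_nonneg) auto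
        then show ?thesis using True by (simp add: abs_mult)
      qed (use G_far in auto)
    qed
    have l1: "(\<lambda>n. ?h1 n x) \<longlonglongrightarrow> g i x * (2 * f x * G (d x))" for x
      by (intro tendsto_intros F_lim G_lim)
    have l2: "(\<lambda>n. ?h2 n x) \<longlonglongrightarrow> g i x * ((f x)\<^sup>2 * G' (d x))" for x
      by (intro tendsto_intros F_lim G'_lim)
    have "(\<lambda>n. \<integral>x. lie (X i) (mollify (real (Suc n)) f) x * ?h1 n x \<partial>lborel)
        \<longlonglongrightarrow> (\<integral>x. u i x * (g i x * (2 * f x * G (d x))) \<partial>lborel)"
      by (rule weak_star_mollify_strong[OF f V[OF i] u[OF i] _ _ b1 AE_I2[OF l1]]) measurable
    then have lim1: "(\<lambda>n. \<integral>x. lie (X i) (F n) x * ?h1 n x \<partial>lborel)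
        \<longlonglongrightarrow> (\<integral>x. u i x * (g i x * (2 * f x * G (d x))) \<partial>lborel)"
      by (simp only: F_def N_def)
    have "(\<lambda>n. \<integral>x. lie (X i) (mollify (real (Suc n)) d) x * ?h2 n x \<partial>lborel)
        \<longlonglongrightarrow> (\<integral>x. g i x * (g i x * ((f x)\<^sup>2 * G' (d x))) \<partial>lborel)"
      by (rule weak_star_mollify_strong[OF d(1) V[OF i] g[OF i] _ _ b2 AE_I2[OF l2]]) measurable
    then have lim2: "(\<lambda>n. \<integral>x. lie (X i) (m n) x * ?h2 n x \<partial>lborel)
        \<longlonglongrightarrow> (\<integral>x. g i x * (g i x * ((f x)\<^sup>2 * G' (d x))) \<partial>lborel)"
      by (simp only: m_def N_def)
    have lie_bounded: "\<exists>L\<ge>0. \<forall>n. \<forall>x\<in>cball 0 R. \<bar>lie (X i) (mollify (N n) w) x\<bar> \<le> L"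
      if "continuous_on UNIV w" "is_weak_deriv (X i) w v" for w v
      using lie_mollify_bounded[OF that(1) V[OF i] that(2), of R] N1 by blast
    have int_prod: "integrable lborel (\<lambda>x. w x * h x)"
      if [measurable]: "w \<in> borel_measurable borel" "h \<in> borel_measurable borel" and "L \<ge> 0"
        and w: "AE x in lborel. x \<in> cball 0 R \<longrightarrow> \<bar>w x\<bar> \<le> L"
        and h: "AE x in lborel. \<bar>h x\<bar> \<le> M * indicator (cball 0 R) x" for w h :: "real^'n \<Rightarrow> real" and L M
    proof (rule integrable_bounded_support)
      show "AE x in lborel. \<bar>w x * h x\<bar> \<le> L * M * indicator (cball 0 R) x"
        using w h
      proof eventually_elim
        case (elim x)
        then show ?case using \<open>L \<ge> 0\<close>
          by (cases "x \<in> cball 0 R") (auto simp: abs_mult intro: mult_mono)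
      qed
    qed measurable
    have int1: "integrable lborel (\<lambda>x. lie (X i) (F n) x * ?h1 n x)" for n
    proof -
      obtain L where "L \<ge> 0" "\<And>x. x \<in> cball 0 R \<Longrightarrow> \<bar>lie (X i) (F n) x\<bar> \<le> L"
        using lie_bounded[OF f u[OF i]] unfolding F_def by blast
      moreover note [measurable] = C_infinity_measurable[OF C_infinity_lie[OF V[OF i] F_smooth]]
      ultimately show ?thesis
        by (intro int_prod[OF _ _ _ _ b1]) auto
    qed
    have int2: "integrable lborel (\<lambda>x. lie (X i) (m n) x * ?h2 n x)" for n
    proof -
      obtain L where "L \<ge> 0" "\<And>x. x \<in> cball 0 R \<Longrightarrow> \<bar>lie (X i) (m n) x\<bar> \<le> L"
        using lie_bounded[OF d(1) g[OF i]] unfolding m_def by blast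
      moreover note [measurable] = C_infinity_measurable[OF C_infinity_lie[OF V[OF i] m_smooth]]
      ultimately show ?thesis
        by (intro int_prod[OF _ _ _ _ b2]) auto
    qed
    have "(\<integral>x. g i x * lie (X i) (\<Phi> n) x \<partial>lborel)
        = (\<integral>x. lie (X i) (F n) x * ?h1 n x \<partial>lborel) + (\<integral>x. lie (X i) (m n) x * ?h2 n x \<partial>lborel)" for n
      unfolding Bochner_Integration.integral_add[OF int1 int2, symmetric]
      by (simp add: lie_\<Phi> algebra_simps)
    moreover have lim_bound: "AE x in lborel. \<bar>h x\<bar> \<le> M * indicator (cball 0 R) x"
      if "\<And>n. AE x in lborel. \<bar>hs n x\<bar> \<le> M * indicator (cball 0 R) x" "\<And>x. (\<lambda>n. hs n x) \<longlonglongrightarrow> h x"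
      for hs :: "nat \<Rightarrow> real^'n \<Rightarrow> real" and h M
    proof -
      have "AE x in lborel. \<forall>n. \<bar>hs n x\<bar> \<le> M * indicator (cball 0 R) x"
        using that(1) by (simp add: AE_all_countable)
      then show ?thesis
      proof eventually_elim
        case (elim x)
        have "(\<lambda>n. \<bar>hs n x\<bar>) \<longlonglongrightarrow> \<bar>h x\<bar>" by (intro tendsto_rabs that)
        then show ?case by (rule LIMSEQ_le_const2) (use elim in auto)
      qed
    qed
    have "integrable lborel (\<lambda>x. u i x * (g i x * (2 * f x * G (d x))))"
      by (rule int_prod[OF _ _ B'(1) B'(2) lim_bound[OF b1 l1]]) measurable
    moreover have "integrable lborel (\<lambda>x. g i x * (g i x * ((f x)\<^sup>2 * G' (d x))))"
      by (rule int_prod[OF _ _ B(1) B(2) lim_bound[OF b2 l2]]) measurable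
    ultimately show ?thesis using tendsto_add[OF lim1 lim2] by (simp add: mult_ac)
  qed

  define H where "H x = (\<Sum>i=1..k. (g i x)\<^sup>2)" for x
  have H_meas: "H \<in> borel_measurable borel"
    unfolding H_def[abs_def] using g_meas by measurable
  obtain BH where BH: "BH \<ge> 0" "AE x in lborel. x \<in> cball 0 R \<longrightarrow> \<bar>H x\<bar> \<le> BH"
  proof -
    have "\<forall>i\<in>{1..k}. \<exists>M\<ge>0. AE x in lborel. x \<in> cball 0 R \<longrightarrow> \<bar>g i x\<bar> \<le> M"
      using is_weak_deriv_bounded[OF g] by blast
    then obtain M where M: "\<And>i. i \<in> {1..k} \<Longrightarrow> AE x in lborel. x \<in> cball 0 R \<longrightarrow> \<bar>g i x\<bar> \<le> M i"
      by metis
    then have "AE x in lborel. \<forall>i\<in>{1..k}. x \<in> cball 0 R \<longrightarrow> \<bar>g i x\<bar> \<le> M i"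
      by (intro AE_finite_allI) auto
    then have "AE x in lborel. x \<in> cball 0 R \<longrightarrow> \<bar>H x\<bar> \<le> (\<Sum>i=1..k. (M i)\<^sup>2)"
    proof eventually_elim
      case (elim x)
      show ?case
      proof
        assume x: "x \<in> cball 0 R"
        have "(g i x)\<^sup>2 \<le> (M i)\<^sup>2" if "i \<in> {1..k}" for i
          using elim x that by (metis abs_ge_zero power2_abs power_mono)
        then show "\<bar>H x\<bar> \<le> (\<Sum>i=1..k. (M i)\<^sup>2)"
          unfolding H_def by (subst abs_of_nonneg) (auto intro: sum_nonneg sum_mono)
      qed
    qed
    then show ?thesis by (intro that[of "\<Sum>i=1..k. (M i)\<^sup>2"]) (auto intro: sum_nonneg)
  qed
  obtain BQ where BQ: "BQ \<ge> 0" "\<And>x. x \<in> cball 0 R \<Longrightarrow> \<bar>Q x\<bar> \<le> BQ"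
    using continuous_bounded_on_cball[OF Q, of 0 R] by auto
  have dct_H: "integrable lborel (\<lambda>x. H x / d x * ((f x)\<^sup>2 * G (d x)))"
    "(\<lambda>n. \<integral>x. H x / d x * \<Phi> n x \<partial>lborel) \<longlonglongrightarrow> (\<integral>x. H x / d x * ((f x)\<^sup>2 * G (d x)) \<partial>lborel)"
    using dct[OF H_meas BH] by auto
  have dct_Q: "integrable lborel (\<lambda>x. Q x / d x * ((f x)\<^sup>2 * G (d x)))"
    "(\<lambda>n. \<integral>x. Q x / d x * \<Phi> n x \<partial>lborel) \<longlonglongrightarrow> (\<integral>x. Q x / d x * ((f x)\<^sup>2 * G (d x)) \<partial>lborel)"
    using dct[of Q BQ] BQ by auto
  let ?S = "cball 0 R \<inter> {x. d x \<ge> 1/4}"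
  have S: "compact ?S" "?S \<subseteq> {x. d x > 0}"
    by (intro compact_Int_closed closed_Collect_le continuous_on_const d(1) compact_cball) auto
  have ineq: "a * (\<integral>x. H x / d x * \<Phi> n x \<partial>lborel)
      - a * (\<Sum>i=1..k. \<integral>x. g i x * lie (X i) (\<Phi> n) x \<partial>lborel)
      \<le> (\<integral>x. Q x / d x * \<Phi> n x \<partial>lborel)" if "n \<ge> n0" for n
    using n0[OF that] unfolding H_def
    by (intro laplacian_tested_with_mollification[OF V g \<Phi>_smooth S _ \<Phi>_nonneg lap]) auto
  define P where "P i x = u i x * (2 * g i x * f x * G (d x)) + g i x * (g i x * (f x)\<^sup>2 * G' (d x))" for i x
  have P_int: "integrable lborel (P i)" if "i \<in> {1..k}" for i
    using lim_i[OF that] unfolding P_def[abs_def] by (intro Bochner_Integration.integrable_add) auto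
  have P_lim: "(\<lambda>n. \<integral>x. g i x * lie (X i) (\<Phi> n) x \<partial>lborel) \<longlonglongrightarrow> (\<integral>x. P i x \<partial>lborel)" if "i \<in> {1..k}" for i
    using lim_i[OF that] unfolding P_def[abs_def] by (subst Bochner_Integration.integral_add) auto
  have "a * (\<integral>x. H x / d x * ((f x)\<^sup>2 * G (d x)) \<partial>lborel) - a * (\<Sum>i=1..k. \<integral>x. P i x \<partial>lborel)
      \<le> (\<integral>x. Q x / d x * ((f x)\<^sup>2 * G (d x)) \<partial>lborel)"
  proof (rule LIMSEQ_le)
    show "(\<lambda>n. a * (\<integral>x. H x / d x * \<Phi> n x \<partial>lborel)
        - a * (\<Sum>i=1..k. \<integral>x. g i x * lie (X i) (\<Phi> n) x \<partial>lborel))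
      \<longlonglongrightarrow> a * (\<integral>x. H x / d x * ((f x)\<^sup>2 * G (d x)) \<partial>lborel) - a * (\<Sum>i=1..k. \<integral>x. P i x \<partial>lborel)"
      by (intro tendsto_diff tendsto_mult tendsto_const tendsto_sum dct_H P_lim)
    show "(\<lambda>n. \<integral>x. Q x / d x * \<Phi> n x \<partial>lborel) \<longlonglongrightarrow> (\<integral>x. Q x / d x * ((f x)\<^sup>2 * G (d x)) \<partial>lborel)"
      by (rule dct_Q)
  qed (use ineq in blast)
  moreover define A1 where "A1 = (\<lambda>x. H x / d x * ((f x)\<^sup>2 * G (d x)))"
  moreover define A2 where "A2 = (\<lambda>x. Q x / d x * ((f x)\<^sup>2 * G (d x)))"
  moreover define A3 where "A3 = (\<lambda>x. \<Sum>i=1..k. P i x)"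
  moreover have "(\<integral>x. A3 x \<partial>lborel) = (\<Sum>i=1..k. \<integral>x. P i x \<partial>lborel)"
    unfolding A3_def by (intro Bochner_Integration.integral_sum P_int)
  ultimately have le: "a * (\<integral>x. A1 x \<partial>lborel) - a * (\<integral>x. A3 x \<partial>lborel) \<le> (\<integral>x. A2 x \<partial>lborel)"
    by (simp only:)
  have J: "J = (\<lambda>x. a * A1 x - a * A3 x - A2 x)"
    unfolding J_def H_def P_def A1_def A2_def A3_def by simp
  have "integrable lborel A1" unfolding A1_def by (rule dct_H(1))
  moreover have "integrable lborel A2" unfolding A2_def by (rule dct_Q(1))
  moreover have "integrable lborel A3"
    unfolding A3_def by (intro Bochner_Integration.integrable_sum P_int)
  ultimately show "integrable lborel J" "(\<integral>x. J x \<partial>lborel) \<le> 0"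
    using le unfolding J by simp_all
qed

subsection \<open>Cutoff functions of the distance\<close>

lemma flat_exp_nonneg: "flat_exp 1 t \<ge> 0"
  by (simp add: flat_exp_def)

lemma flat_exp_le_1: "flat_exp 1 t \<le> 1"
  by (simp add: flat_exp_def)

lemma flat_exp_1_deriv: "(flat_exp 1 has_field_derivative flat_exp (monom 1 2) t) (at t)"
  using flat_exp_has_derivative[of 1 t] by (simp add: pderiv_1)

text \<open>This is v^2 e^(-v) with v = 1/t, the derivative of e^(-1/t). Squaring v/2 <= e^(v/2)
  gives the crude bound 4, which is enough because only its independence of \<open>T\<close> matters
  later.\<close>

lemma flat_exp_deriv_bounds: "0 \<le> flat_exp (monom 1 2) t" "flat_exp (monom 1 2) t \<le> 4"
proof -
  show "0 \<le> flat_exp (monom 1 2) t" by (simp add: flat_exp_def poly_monom)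
  show "flat_exp (monom 1 2) t \<le> 4"
  proof (cases "t > 0")
    case True
    define v where "v = 1 / t"
    have v: "v > 0" using True by (simp add: v_def)
    have "v / 2 \<le> exp (v / 2)" using exp_ge_add_one_self[of "v / 2"] by linarith
    then have "(v / 2)\<^sup>2 \<le> (exp (v / 2))\<^sup>2" using v by (intro power_mono) auto
    also have "(exp (v / 2))\<^sup>2 = exp v" by (simp flip: exp_double)
    finally have "v\<^sup>2 \<le> 4 * exp v" by (simp add: power_divide)
    then have "v\<^sup>2 * exp (- v) \<le> 4" by (simp add: exp_minus field_simps)
    then show ?thesis using True by (simp add: flat_exp_def poly_monom v_def)
  qed (simp add: flat_exp_def)
qed

lemma isCont_flat_exp: "isCont (flat_exp q) t"
  using flat_exp_has_derivative DERIV_isCont by blast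

text \<open>There is no plateau: between 1 and \<open>T\<close> the function is merely bounded below
  by a constant independent of \<open>T\<close>. This costs a constant factor and makes the cutoff a
  plain product of two explicit smooth functions.\<close>

definition cutoff :: "real \<Rightarrow> real \<Rightarrow> real" where
  "cutoff T t = flat_exp 1 (t - 1/2) * flat_exp 1 (T + 1 - t)"

definition cutoff_deriv :: "real \<Rightarrow> real \<Rightarrow> real" where
  "cutoff_deriv T t = flat_exp (monom 1 2) (t - 1/2) * flat_exp 1 (T + 1 - t)
     - flat_exp 1 (t - 1/2) * flat_exp (monom 1 2) (T + 1 - t)"

lemma cutoff_has_derivative: "(cutoff T has_field_derivative cutoff_deriv T t) (at t)"
  unfolding cutoff_def[abs_def] cutoff_deriv_def
  by (auto intro!: derivative_eq_intros DERIV_chain2[OF flat_exp_1_deriv])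

lemma isCont_cutoff: "isCont (cutoff T) t"
  using cutoff_has_derivative by (rule DERIV_isCont)

lemma isCont_cutoff_deriv: "isCont (cutoff_deriv T) t"
  unfolding cutoff_deriv_def[abs_def]
  by (intro continuous_intros isCont_o2[OF _ isCont_flat_exp])

lemma cutoff_nonneg: "0 \<le> cutoff T t" and cutoff_le_1: "cutoff T t \<le> 1"
  by (simp_all add: cutoff_def flat_exp_nonneg flat_exp_le_1 mult_le_one)

text \<open>The derivative is a difference of two numbers in the interval from 0 to 4, so the bounds
  do not add up to 8.\<close>

lemma cutoff_deriv_bound: "\<bar>cutoff_deriv T t\<bar> \<le> 4"
proof -
  have "0 \<le> flat_exp (monom 1 2) s * flat_exp 1 r" "flat_exp (monom 1 2) s * flat_exp 1 r \<le> 4 * 1" for s r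
    by (intro mult_nonneg_nonneg mult_mono flat_exp_deriv_bounds flat_exp_nonneg flat_exp_le_1; simp)+
  from this[of "t - 1/2" "T + 1 - t"] this[of "T + 1 - t" "t - 1/2"]
  show ?thesis unfolding cutoff_deriv_def by (simp add: mult.commute abs_le_iff)
qed

lemma cutoff_support: "t \<notin> {1/2..T + 1} \<Longrightarrow> cutoff T t = 0 \<and> cutoff_deriv T t = 0"
  by (auto simp: cutoff_def cutoff_deriv_def flat_exp_def)

lemma cutoff_ge:
  assumes "1 \<le> t" "t \<le> T"
  shows "exp (- 3) \<le> cutoff T t"
proof -
  \<comment> \<open>The rising factor is at least e^(-2), since t is at least 1/2 above its zero,
    and the falling factor is at least e^(-1), since t is at least 1 below its zero.\<close>
  have "1 / (t - 1/2) \<le> 2" "1 / (T + 1 - t) \<le> 1"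
    using assms by (simp_all add: field_simps)
  then have "exp (- 3) \<le> exp (- (1 / (t - 1/2)) + - (1 / (T + 1 - t)))" by simp
  also have "\<dots> = cutoff T t" using assms by (simp only: exp_add cutoff_def flat_exp_def) simp
  finally show ?thesis .
qed

lemma C_infinity_cutoff: "C_infinity h \<Longrightarrow> C_infinity (\<lambda>x. cutoff T (h x))"
  unfolding cutoff_def
  by (intro C_infinity_mult C_infinity_flat_exp C_infinity_diff C_infinity_const)

subsection \<open>The pointwise estimate\<close>

text \<open>
  Completing the square: with \<open>w\<^sub>i = \<chi> u\<^sub>i + f \<chi>' g\<^sub>i\<close>, the gradient of \<open>f \<chi>\<close>, the weight \<open>t powr (2 - p)\<close> is
  dual to \<open>t powr p\<close> because their geometric mean is \<open>t\<close>.
\<close>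

lemma cross_term_bound:
  fixes g u :: "nat \<Rightarrow> real"
  assumes t: "t > 0"
  shows "p * \<beta> * f * c * t * (c * (\<Sum>i\<in>I. u i * g i) + f * c' * (\<Sum>i\<in>I. (g i)\<^sup>2))
    \<le> p\<^sup>2 * \<beta>\<^sup>2 / 4 * (f * c)\<^sup>2 * t powr p * (\<Sum>i\<in>I. (g i)\<^sup>2)
      + t powr (2 - p) * (2 * c\<^sup>2 * (\<Sum>i\<in>I. (u i)\<^sup>2) + 2 * f\<^sup>2 * c'\<^sup>2 * (\<Sum>i\<in>I. (g i)\<^sup>2))"
proof -
  define P where "P = t powr (p / 2)"
  define R where "R = t powr (1 - p / 2)"
  have PR: "P * R = t" and PP: "P\<^sup>2 = t powr p" and RR: "R\<^sup>2 = t powr (2 - p)"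
    using t by (simp_all add: P_def R_def power2_eq_square flip: powr_add)
  have one: "p * \<beta> * f * c * t * (g i * (c * u i + f * c' * g i))
      \<le> p\<^sup>2 * \<beta>\<^sup>2 / 4 * (f * c)\<^sup>2 * t powr p * (g i)\<^sup>2
        + t powr (2 - p) * (2 * c\<^sup>2 * (u i)\<^sup>2 + 2 * f\<^sup>2 * c'\<^sup>2 * (g i)\<^sup>2)" for i
  proof -
    \<comment> \<open>\<open>?x\<close> carries the root of t^p and \<open>R * ?w\<close> the root
      of t^(2-p); since \<open>P * R = t\<close>, the left side is exactly twice their
      product.\<close>
    let ?x = "p * \<beta> / 2 * (f * c) * P * g i" and ?w = "c * u i + f * c' * g i"
    have "p * \<beta> * f * c * t * (g i * ?w) = 2 * ?x * (R * ?w)"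
      by (simp add: PR[symmetric])
    also have "\<dots> \<le> ?x\<^sup>2 + (R * ?w)\<^sup>2" by (rule sum_squares_bound)
    also have "(R * ?w)\<^sup>2 \<le> R\<^sup>2 * (2 * (c * u i)\<^sup>2 + 2 * (f * c' * g i)\<^sup>2)"
      unfolding power_mult_distrib[of R]
      using sum_squares_bound[of "c * u i" "f * c' * g i"]
      by (intro mult_left_mono) (auto simp: power2_sum)
    also have "?x\<^sup>2 + R\<^sup>2 * (2 * (c * u i)\<^sup>2 + 2 * (f * c' * g i)\<^sup>2)
      = p\<^sup>2 * \<beta>\<^sup>2 / 4 * (f * c)\<^sup>2 * P\<^sup>2 * (g i)\<^sup>2 + R\<^sup>2 * (2 * c\<^sup>2 * (u i)\<^sup>2 + 2 * f\<^sup>2 * c'\<^sup>2 * (g i)\<^sup>2)"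
      by (simp add: power_mult_distrib power_divide)
    finally show ?thesis unfolding PP RR by simp
  qed
  have "(\<Sum>i\<in>I. p * \<beta> * f * c * t * (g i * (c * u i + f * c' * g i)))
      \<le> (\<Sum>i\<in>I. p\<^sup>2 * \<beta>\<^sup>2 / 4 * (f * c)\<^sup>2 * t powr p * (g i)\<^sup>2
        + t powr (2 - p) * (2 * c\<^sup>2 * (u i)\<^sup>2 + 2 * f\<^sup>2 * c'\<^sup>2 * (g i)\<^sup>2))"
    by (intro sum_mono one)
  also have "(\<Sum>i\<in>I. p * \<beta> * f * c * t * (g i * (c * u i + f * c' * g i)))
      = p * \<beta> * f * c * t * (\<Sum>i\<in>I. c * (u i * g i) + f * c' * (g i)\<^sup>2)"
    by (simp add: sum_distrib_left power2_eq_square algebra_simps)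
  also have "(\<Sum>i\<in>I. c * (u i * g i) + f * c' * (g i)\<^sup>2)
      = c * (\<Sum>i\<in>I. u i * g i) + f * c' * (\<Sum>i\<in>I. (g i)\<^sup>2)"
    by (simp add: sum.distrib sum_distrib_left)
  finally show ?thesis
    by (simp add: sum.distrib sum_distrib_left distrib_left)
qed

text \<open>For t >= 1/2 one has 1 + t^2 <= 5 t^2 <= (3 t)^2, and the exponent 2 - p is negative.
  Here the weight singular at the origin is exchanged for the regular one of the theorem.\<close>

lemma powr_bracket_bound:
  assumes "t \<ge> 1/2" "p > 2"
  shows "t powr (2 - p) \<le> 3 powr (p - 2) * bracket t powr (2 - p)"
proof -
  have "(1/2)\<^sup>2 \<le> t\<^sup>2" using assms(1) by (intro power_mono) auto
  then have "1 + t\<^sup>2 \<le> (3 * t)\<^sup>2" by (simp add: power2_eq_square)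
  then have "bracket t \<le> 3 * t"
    unfolding bracket_def using assms by (intro real_le_lsqrt) auto
  moreover have "bracket t > 0" by (simp add: bracket_def add_pos_nonneg)
  ultimately have "(3 * t) powr (2 - p) \<le> bracket t powr (2 - p)"
    using assms(2) by (intro powr_mono2') auto
  moreover have "3 powr (p - 2) * (3 * t) powr (2 - p) = t powr (2 - p)"
    using assms(1) by (simp add: powr_mult flip: powr_add mult.assoc)
  ultimately show ?thesis using mult_left_mono[of _ _ "3 powr (p - 2) :: real"] by (metis powr_ge_zero)
qed

text \<open>Pure algebra at one point, with \<open>t\<close> for the distance, \<open>c\<close> and
  \<open>c'\<close> for the cutoff and its derivative, and \<open>E\<close> for the exponential
  weight. \<open>G'\<close> is the derivative of \<open>G\<close> in the application, where
  \<open>E\<close> has logarithmic derivative -beta p t^(p-1).\<close>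

lemma pointwise_bound:
  fixes g u :: "nat \<Rightarrow> real" and I :: "nat set" and f :: real
  defines "H \<equiv> (\<Sum>i\<in>I. (g i)\<^sup>2)" and "U \<equiv> (\<Sum>i\<in>I. (u i)\<^sup>2)"
  assumes t: "t \<ge> 1/2" and p: "p > 2" and c: "0 \<le> c" "c \<le> 1" and c': "\<bar>c'\<bar> \<le> 4"
    and \<sigma>: "\<sigma> > 0" and H: "1 / \<sigma>\<^sup>2 \<le> H" "H \<le> 1" and K: "K > 0"
    and G: "G = t * E * c\<^sup>2" and G': "G' = E * (c\<^sup>2 - \<beta> * p * t powr p * c\<^sup>2 + 2 * t * c * c')" and E: "E > 0"
    and J: "J = p * \<beta> / 2 * (H / t * (f\<^sup>2 * G))
      - p * \<beta> / 2 * (\<Sum>i\<in>I. u i * (2 * g i * f * G) + g i * (g i * f\<^sup>2 * G'))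
      - (K + \<delta> * t powr p) / t * (f\<^sup>2 * G)"
  shows "(p\<^sup>2 * \<beta>\<^sup>2 / (4 * \<sigma>\<^sup>2) - \<delta>) * ((f * c)\<^sup>2 * t powr p) * E - J
    \<le> (2 * 3 powr (p - 2) * (bracket t powr (2 - p) * U) + (K + 32 * (1/2) powr (2 - p)) * f\<^sup>2) * E"
proof -
  let ?s = "\<Sum>i\<in>I. u i * g i"
  have t0: "t > 0" using t by simp
  have sum: "(\<Sum>i\<in>I. u i * (2 * g i * f * G) + g i * (g i * f\<^sup>2 * G')) = 2 * f * G * ?s + f\<^sup>2 * G' * H"
    by (simp add: H_def sum.distrib sum_distrib_left power2_eq_square mult_ac)
  \<comment> \<open>\<open>L\<close> is \<open>J\<close> without the weight \<open>E\<close>. The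
    term \<open>E * c\<^sup>2\<close> of \<open>G'\<close> has cancelled the first summand of
    \<open>J\<close>, and its term in t^p has become the coercive one with coefficient p^2 beta^2 /
    2.\<close>
  define L where "L = - (p * \<beta> * f * c * t * (c * ?s + f * c' * H))
    + p\<^sup>2 * \<beta>\<^sup>2 / 2 * t powr p * H * (f * c)\<^sup>2 - (K + \<delta> * t powr p) * (f * c)\<^sup>2"
  have Gt: "G / t = E * c\<^sup>2" using t0 by (simp add: G)
  have "J = p * \<beta> / 2 * (H * (f\<^sup>2 * (G / t))) - p * \<beta> / 2 * (2 * f * G * ?s + f\<^sup>2 * G' * H)
      - (K + \<delta> * t powr p) * (f\<^sup>2 * (G / t))"
    unfolding J sum by simp
  then have J_eq: "J = E * L"
    unfolding L_def Gt unfolding G G' by (simp add: field_simps power2_eq_square)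
  have cross: "p * \<beta> * f * c * t * (c * ?s + f * c' * H)
    \<le> p\<^sup>2 * \<beta>\<^sup>2 / 4 * (f * c)\<^sup>2 * t powr p * H + t powr (2 - p) * (2 * c\<^sup>2 * U + 2 * f\<^sup>2 * c'\<^sup>2 * H)"
    unfolding H_def U_def by (rule cross_term_bound[OF t0])
  have coerc: "p\<^sup>2 * \<beta>\<^sup>2 / 4 * (f * c)\<^sup>2 * t powr p * (1 / \<sigma>\<^sup>2) \<le> p\<^sup>2 * \<beta>\<^sup>2 / 4 * (f * c)\<^sup>2 * t powr p * H"
    using H(1) by (intro mult_left_mono) auto
  have U0: "U \<ge> 0" and H0: "H \<ge> 0" by (auto simp: U_def H_def intro: sum_nonneg)
  have c2: "c\<^sup>2 \<le> 1" using c by (simp add: power_le_one)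
  have "\<bar>c'\<bar>\<^sup>2 \<le> 4\<^sup>2" using c' by (intro power_mono) auto
  then have c'2: "c'\<^sup>2 \<le> 16" by simp
  have "c'\<^sup>2 * H \<le> 16 * 1" using c'2 H(2) H0 by (intro mult_mono) auto
  then have "2 * f\<^sup>2 * (c'\<^sup>2 * H) \<le> 2 * f\<^sup>2 * 16" by (intro mult_left_mono) auto
  moreover have "2 * c\<^sup>2 * U \<le> 2 * U" using c2 U0 by (simp add: mult_left_le_one_le)
  ultimately have "t powr (2 - p) * (2 * c\<^sup>2 * U + 2 * f\<^sup>2 * c'\<^sup>2 * H) \<le> t powr (2 - p) * (2 * U + 32 * f\<^sup>2)"
    by (intro mult_left_mono) (auto simp: mult_ac)
  also have "\<dots> = t powr (2 - p) * (2 * U) + t powr (2 - p) * (32 * f\<^sup>2)"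
    by (simp add: distrib_left)
  \<comment> \<open>The weight t^(2-p) is bounded in two ways: by the bracket weight for the
    gradient, and by its largest value, at t = 1/2, for f^2. The 32 is 2 times the squared bound 4
    on the cutoff derivative.\<close>
  also have "\<dots> \<le> 3 powr (p - 2) * bracket t powr (2 - p) * (2 * U) + (1/2) powr (2 - p) * (32 * f\<^sup>2)"
    using powr_bracket_bound[OF t p] U0 t p by (intro add_mono mult_right_mono powr_mono2') auto
  finally have tail: "t powr (2 - p) * (2 * c\<^sup>2 * U + 2 * f\<^sup>2 * c'\<^sup>2 * H)
      \<le> 3 powr (p - 2) * bracket t powr (2 - p) * (2 * U) + (1/2) powr (2 - p) * (32 * f\<^sup>2)" .
  have "(f * c)\<^sup>2 \<le> f\<^sup>2" using c2 by (simp add: power_mult_distrib mult_left_le)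
  then have Kf: "K * (f * c)\<^sup>2 \<le> K * f\<^sup>2" using K by (intro mult_left_mono) auto
  \<comment> \<open>The coercive term equals \<open>2 * (A * H)\<close>; one \<open>A * H\<close>
    pays for the cross term and the other yields the constant with \<open>\<sigma>\<close>.\<close>
  define A where "A = p\<^sup>2 * \<beta>\<^sup>2 / 4 * (f * c)\<^sup>2 * t powr p"
  have "L = - (p * \<beta> * f * c * t * (c * ?s + f * c' * H)) + 2 * (A * H)
      - K * (f * c)\<^sup>2 - \<delta> * ((f * c)\<^sup>2 * t powr p)"
    unfolding L_def A_def by (simp add: algebra_simps)
  moreover have "(p\<^sup>2 * \<beta>\<^sup>2 / (4 * \<sigma>\<^sup>2) - \<delta>) * ((f * c)\<^sup>2 * t powr p)
      = A * (1 / \<sigma>\<^sup>2) - \<delta> * ((f * c)\<^sup>2 * t powr p)"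
    unfolding A_def by (simp add: algebra_simps)
  moreover have "3 powr (p - 2) * bracket t powr (2 - p) * (2 * U) + (1/2) powr (2 - p) * (32 * f\<^sup>2) + K * f\<^sup>2
      = 2 * 3 powr (p - 2) * (bracket t powr (2 - p) * U) + (K + 32 * (1/2) powr (2 - p)) * f\<^sup>2"
    by (simp add: algebra_simps)
  ultimately have "(p\<^sup>2 * \<beta>\<^sup>2 / (4 * \<sigma>\<^sup>2) - \<delta>) * ((f * c)\<^sup>2 * t powr p) - L
    \<le> 2 * 3 powr (p - 2) * (bracket t powr (2 - p) * U) + (K + 32 * (1/2) powr (2 - p)) * f\<^sup>2"
    using cross[folded A_def] coerc[folded A_def] tail Kf by linarith
  from mult_right_mono[OF this, of E] E show ?thesis
    unfolding J_eq by (simp add: left_diff_distrib mult.commute[of E])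
qed

subsection \<open>The integrated estimate\<close>

text \<open>No sign of \<open>h\<close> is assumed: \<open>ennreal\<close> maps negative values to
  0, so the right side integrates the positive part.\<close>

lemma integral_le_nn_integral:
  fixes h :: "'a \<Rightarrow> real"
  assumes "integrable M h"
  shows "ennreal (\<integral>x. h x \<partial>M) \<le> (\<integral>\<^sup>+x. ennreal (h x) \<partial>M)"
proof -
  have i: "integrable M (\<lambda>x. max 0 (h x))" using assms by (intro integrable_max) auto
  have "(\<integral>x. h x \<partial>M) \<le> (\<integral>x. max 0 (h x) \<partial>M)"
    using assms i by (intro integral_mono) auto
  then have "ennreal (\<integral>x. h x \<partial>M) \<le> ennreal (\<integral>x. max 0 (h x) \<partial>M)" by (rule ennreal_leI)
  also have "\<dots> = (\<integral>\<^sup>+x. ennreal (max 0 (h x)) \<partial>M)"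
    by (rule nn_integral_eq_integral[symmetric, OF i]) auto
  also have "\<dots> = (\<integral>\<^sup>+x. ennreal (h x) \<partial>M)"
    by (simp add: max_def ennreal_neg if_distrib cong: nn_integral_cong)
      (auto intro!: nn_integral_cong simp: ennreal_neg)
  finally show ?thesis .
qed

text \<open>Since \<open>J\<close> has nonpositive integral, the integral of \<open>S\<close> is at
  most that of \<open>S - J\<close>, which is bounded pointwise by \<open>W\<close>. The right side
  keeps no trace of the cutoff, so it is the same for all \<open>T\<close>.\<close>

lemma weighted_estimate_on_shell:
  fixes X :: "nat \<Rightarrow> real^'n::finite \<Rightarrow> real^'n" and d f :: "real^'n \<Rightarrow> real"
    and g u :: "nat \<Rightarrow> real^'n \<Rightarrow> real" and p \<beta> \<sigma> K \<delta> T :: real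
  assumes V: "\<And>i. i \<in> {1..k} \<Longrightarrow> smooth_div_free (X i)"
    and g: "\<And>i. i \<in> {1..k} \<Longrightarrow> is_weak_deriv (X i) d (g i)"
    and u: "\<And>i. i \<in> {1..k} \<Longrightarrow> is_weak_deriv (X i) f (u i)"
    and d: "continuous_on UNIV d" "\<And>x. d x \<ge> 0" "\<And>R. compact {x. d x \<le> R}"
    and f: "continuous_on UNIV f"
    and p: "p > 2" and \<sigma>: "\<sigma> > 0" and K: "K > 0" and \<delta>: "\<delta> < p\<^sup>2 * \<beta>\<^sup>2 / (4 * \<sigma>\<^sup>2)"
    and grad_le: "AE x in lborel. (\<Sum>i=1..k. (g i x)\<^sup>2) \<le> 1"
    and grad_ge: "AE x in lborel. 1 / \<sigma>\<^sup>2 \<le> (\<Sum>i=1..k. (g i x)\<^sup>2)"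
    and lap: "distr_le_on {x. d x > 0}
      (\<lambda>\<phi>. p * \<beta> / 2 * regular_distr (\<lambda>x. (\<Sum>i=1..k. (g i x)\<^sup>2) / d x) \<phi>
        + p * \<beta> / 2 * distr_laplacian X k (regular_distr d) \<phi>)
      (regular_distr (\<lambda>x. (K + \<delta> * d x powr p) / d x))"
  shows "(\<integral>\<^sup>+x. ennreal ((p\<^sup>2 * \<beta>\<^sup>2 / (4 * \<sigma>\<^sup>2) - \<delta>) * exp (- 6) * ((f x)\<^sup>2 * d x powr p) * exp (- \<beta> * d x powr p))
        * indicator {x. 1 \<le> d x \<and> d x \<le> T} x \<partial>lborel)
    \<le> (\<integral>\<^sup>+x. ennreal ((2 * 3 powr (p - 2) * (bracket (d x) powr (2 - p) * (\<Sum>i=1..k. (u i x)\<^sup>2))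
        + (K + 32 * (1/2) powr (2 - p)) * (f x)\<^sup>2) * exp (- \<beta> * d x powr p)) \<partial>lborel)"
proof -
  define E where "E t = exp (- \<beta> * t powr p)" for t
  define G where "G t = t * E t * (cutoff T t)\<^sup>2" for t
  define G' where "G' t = E t * ((cutoff T t)\<^sup>2 - \<beta> * p * t powr p * (cutoff T t)\<^sup>2
      + 2 * t * cutoff T t * cutoff_deriv T t)" for t
  define Q where "Q x = K + \<delta> * d x powr p" for x
  define J where "J = (\<lambda>x. p * \<beta> / 2 * ((\<Sum>i=1..k. (g i x)\<^sup>2) / d x * ((f x)\<^sup>2 * G (d x)))
      - p * \<beta> / 2 * (\<Sum>i=1..k. u i x * (2 * g i x * f x * G (d x)) + g i x * (g i x * (f x)\<^sup>2 * G' (d x)))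
      - Q x / d x * ((f x)\<^sup>2 * G (d x)))"
  have dp: "continuous_on UNIV (\<lambda>x. d x powr p)"
    using d p by (intro continuous_on_powr') auto
  have Q: "continuous_on UNIV Q"
    unfolding Q_def[abs_def] by (intro continuous_intros dp)
  have G_smooth: "C_infinity (\<lambda>x. G (h x))" if h: "C_infinity h" "\<And>x::real^'n. h x > 0" for h
    unfolding G_def E_def power2_eq_square
    by (intro C_infinity_mult C_infinity_exp C_infinity_cutoff C_infinity_powr C_infinity_const h)
  have G_deriv: "(G has_field_derivative G' t) (at t)" if "t > 0" for t
  proof -
    have tp: "t powr p = t * t powr (p - 1)"
      using that powr_mult_base[of t "p - 1"] by simp
    have "(E has_field_derivative E t * (- \<beta> * (p * t powr (p - 1)))) (at t)"
      unfolding E_def[abs_def] using that by (auto intro!: derivative_eq_intros)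
    then show ?thesis
      unfolding G_def[abs_def] G'_def tp
      by (auto intro!: derivative_eq_intros cutoff_has_derivative simp: algebra_simps power2_eq_square)
  qed
  have G'_cont: "isCont G' t" if "t > 0" for t
    unfolding G'_def[abs_def] E_def using that
    by (intro continuous_intros isCont_cutoff isCont_cutoff_deriv) auto
  have supp: "G t = 0 \<and> G' t = 0" if "t \<notin> {1/2..T + 1}" for t
    using cutoff_support[OF that] by (simp add: G_def G'_def)
  have G_nonneg: "G t \<ge> 0" for t
  proof (cases "t \<ge> 0")
    \<comment> \<open>For negative \<open>t\<close> the factor \<open>t\<close> has the wrong sign,
      but the cutoff vanishes there.\<close>
    case False
    then show ?thesis using supp[of t] by simp
  qed (simp add: G_def E_def)
  have J: "integrable lborel J" "(\<integral>x. J x \<partial>lborel) \<le> 0"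
    by (rule laplacian_tested_with_class_L[OF V g u d f Q lap[folded Q_def] G_smooth G_deriv G'_cont
      G_nonneg supp J_def]; assumption)+

  let ?c0 = "p\<^sup>2 * \<beta>\<^sup>2 / (4 * \<sigma>\<^sup>2) - \<delta>"
  define S where "S x = ?c0 * ((f x * cutoff T (d x))\<^sup>2 * d x powr p) * E (d x)" for x
  define W where "W x = (2 * 3 powr (p - 2) * (bracket (d x) powr (2 - p) * (\<Sum>i=1..k. (u i x)\<^sup>2))
        + (K + 32 * (1/2) powr (2 - p)) * (f x)\<^sup>2) * E (d x)" for x
  have W_nonneg: "W x \<ge> 0" for x
    unfolding W_def E_def using K by (auto intro!: mult_nonneg_nonneg add_nonneg_nonneg sum_nonneg)
  \<comment> \<open>The cutoff gives \<open>S\<close> compact support. Its integrability is what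
    permits subtracting \<open>J\<close> although nothing is known about the integrability of
    \<open>W\<close>.\<close>
  have S_int: "integrable lborel S"
  proof -
    obtain R where R: "\<forall>x\<in>{x. d x \<le> T + 1}. norm x \<le> R"
      using compact_imp_bounded[OF d(3)] unfolding bounded_iff by blast
    have cut: "continuous_on UNIV (\<lambda>x. cutoff T (d x))"
      by (rule continuous_on_compose2[OF continuous_at_imp_continuous_on d(1)]) (auto simp: isCont_cutoff)
    have "continuous_on UNIV S"
      unfolding S_def[abs_def] E_def by (intro continuous_intros dp cut f)
    moreover have "S x = 0" if "x \<notin> cball 0 R" for x
    proof -
      have "d x > T + 1" using R that by (auto simp: not_le[symmetric])
      then show ?thesis using cutoff_support[of "d x" T] by (simp add: S_def)
    qed
    ultimately show ?thesis by (rule integrable_continuous_support)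
  qed
  have bound: "AE x in lborel. S x - J x \<le> W x"
    using grad_le grad_ge
  proof eventually_elim
    case (elim x)
    show ?case
    proof (cases "d x \<ge> 1/2")
      case True
      show ?thesis
        unfolding S_def W_def
        by (rule pointwise_bound[where g = "\<lambda>i. g i x" and I = "{1..k}" and G = "G (d x)" and G' = "G' (d x)"
              and c' = "cutoff_deriv T (d x)"])
          (use True p cutoff_nonneg cutoff_le_1 cutoff_deriv_bound \<sigma> elim K in
            \<open>auto simp: G_def G'_def E_def J_def Q_def\<close>)
    next
      case False
      then have "d x \<notin> {1/2..T + 1}" by simp
      then have "S x = 0" "J x = 0"
        using supp[of "d x"] cutoff_support[of "d x" T] by (simp_all add: S_def J_def)
      then show ?thesis using W_nonneg by simp
    qed
  qed
  have "(\<integral>\<^sup>+x. ennreal (?c0 * exp (- 6) * ((f x)\<^sup>2 * d x powr p) * E (d x))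
        * indicator {x. 1 \<le> d x \<and> d x \<le> T} x \<partial>lborel) \<le> (\<integral>\<^sup>+x. ennreal (S x) \<partial>lborel)"
  proof (rule nn_integral_mono)
    fix x
    show "ennreal (?c0 * exp (- 6) * ((f x)\<^sup>2 * d x powr p) * E (d x))
        * indicator {x. 1 \<le> d x \<and> d x \<le> T} x \<le> ennreal (S x)"
    proof (cases "1 \<le> d x \<and> d x \<le> T")
      \<comment> \<open>The cutoff enters \<open>S\<close> squared, so its lower bound e^(-3) on the
        shell becomes e^(-6).\<close>
      case True
      have "(exp (- 3))\<^sup>2 \<le> (cutoff T (d x))\<^sup>2"
        using True by (intro power_mono cutoff_ge) auto
      then have "exp (- 6) \<le> (cutoff T (d x))\<^sup>2" by (simp flip: exp_double)
      then have "?c0 * exp (- 6) * ((f x)\<^sup>2 * d x powr p) * E (d x)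
          \<le> ?c0 * (cutoff T (d x))\<^sup>2 * ((f x)\<^sup>2 * d x powr p) * E (d x)"
        using \<delta> by (intro mult_right_mono mult_left_mono) (auto simp: E_def)
      also have "\<dots> = S x" by (simp add: S_def power_mult_distrib mult_ac)
      finally show ?thesis using True by (simp add: ennreal_leI)
    qed simp
  qed
  also have "\<dots> = ennreal (\<integral>x. S x \<partial>lborel)"
    using \<delta> by (intro nn_integral_eq_integral S_int AE_I2) (auto simp: S_def E_def)
  also have "\<dots> \<le> ennreal (\<integral>x. S x - J x \<partial>lborel)"
    using J(2) Bochner_Integration.integral_diff[OF S_int J(1)] by (intro ennreal_leI) linarith
  also have "\<dots> \<le> (\<integral>\<^sup>+x. ennreal (S x - J x) \<partial>lborel)"
    by (intro integral_le_nn_integral Bochner_Integration.integrable_diff S_int J(1))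
  also have "\<dots> \<le> (\<integral>\<^sup>+x. ennreal (W x) \<partial>lborel)"
    using bound by (intro nn_integral_mono_AE) (auto elim!: eventually_mono intro: ennreal_leI)
  finally show ?thesis unfolding W_def E_def .
qed

section \<open>From the shells to the probability measure\<close>

lemma class_L_weak_deriv:
  assumes "f \<in> class_L X k" "i \<in> {1..k}"
  shows "is_weak_deriv (X i) f (weak_deriv (X i) f)"
proof -
  have "\<exists>g. is_weak_deriv (X i) f g" using assms unfolding class_L_def by blast
  then show ?thesis unfolding weak_deriv_def by (rule someI_ex)
qed

lemma grad_norm_nonneg: "grad_norm X k f x \<ge> 0"
  by (simp add: grad_norm_def sum_nonneg)

lemma grad_norm_squared: "(grad_norm X k f x)\<^sup>2 = (\<Sum>i=1..k. (weak_deriv (X i) f x)\<^sup>2)"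
  by (simp add: grad_norm_def sum_nonneg)

theorem theorem5p1:
  fixes X :: "nat \<Rightarrow> real^'n::finite \<Rightarrow> real^'n"
    and k :: nat
    and \<rho> :: "real^'n \<Rightarrow> real^'n \<Rightarrow> real"
    and d :: "real^'n \<Rightarrow> real"
    and p \<beta> Z \<sigma> K \<delta> :: real
    and \<mu> :: "(real^'n) measure"
  assumes X_smooth: "\<forall>i\<in>{1..k}. smooth_vector_field (X i)"
    and X_div: "\<forall>i\<in>{1..k}. \<forall>x. divergence (X i) x = 0"
    and metric: "Metric_space UNIV \<rho>"
    and d_def: "d = \<rho> 0"
    and d_L: "d \<in> class_L X k"
    and d_grad_le: "AE x in lborel. grad_norm X k d x \<le> 1"
    and d_balls: "\<forall>R. compact {x. d x \<le> R}"
    and p: "p > 2"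
    and \<beta>: "\<beta> > 0"
    and \<mu>_def: "\<mu> = density lborel (\<lambda>x. ennreal (exp (- \<beta> * d x powr p) / Z))"
    and \<mu>_prob: "prob_space \<mu>"
    and \<sigma>: "\<sigma> \<ge> 1"
    and K: "K > 0"
    and \<delta>: "0 < \<delta>" "\<delta> < p\<^sup>2 * \<beta>\<^sup>2 / (4 * \<sigma>\<^sup>2)"
    and d_grad_ge: "AE x in lborel. grad_norm X k d x \<ge> 1 / \<sigma>"
    and d_laplacian: "distr_le_on {x. d x > 0}
      (\<lambda>\<phi>. p * \<beta> / 2 * regular_distr (\<lambda>x. (grad_norm X k d x)\<^sup>2 / d x) \<phi>
          + p * \<beta> / 2 * distr_laplacian X k (regular_distr d) \<phi>)
      (regular_distr (\<lambda>x. (K + \<delta> * d x powr p) / d x))"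
  shows "\<exists>C D. C > 0 \<and> D > 0 \<and>
    (\<forall>f\<in>class_L X k.
      (\<integral>\<^sup>+ x. ennreal ((f x)\<^sup>2 * d x powr p) \<partial>\<mu>)
      \<le> ennreal C * (\<integral>\<^sup>+ x. ennreal (bracket (d x) powr (2 - p) * (grad_norm X k f x)\<^sup>2) \<partial>\<mu>)
        + ennreal D * (\<integral>\<^sup>+ x. ennreal ((f x)\<^sup>2) \<partial>\<mu>))"
proof -
  have V: "smooth_div_free (X i)" if "i \<in> {1..k}" for i
    using X_smooth X_div that by (simp add: smooth_div_free_def)
  have d_cont: "continuous_on UNIV d" using d_L by (simp add: class_L_def)
  have d_nonneg: "d x \<ge> 0" for x using Metric_space.nonneg[OF metric] by (simp add: d_def)
  have [measurable]: "d \<in> borel_measurable borel"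
    using d_cont by (rule borel_measurable_continuous_onI)
  have Z: "Z > 0"
  proof (rule ccontr)
    assume "\<not> Z > 0"
    \<comment> \<open>This includes Z = 0, where division yields 0. In either case
      \<open>ennreal\<close> makes the density vanish, contradicting total mass 1.\<close>
    then have "exp (- \<beta> * d x powr p) / Z \<le> 0" for x by (simp add: divide_nonneg_nonpos)
    then have "\<mu> = density lborel (\<lambda>x. 0)" unfolding \<mu>_def by (simp add: ennreal_neg)
    then have "emeasure \<mu> (space \<mu>) = 0" by (simp add: emeasure_density)
    then show False using prob_space.emeasure_space_1[OF \<mu>_prob] by simp
  qed
  have "AE x in lborel. (\<Sum>i=1..k. (weak_deriv (X i) d x)\<^sup>2) \<le> 1"
    using d_grad_le
  proof eventually_elim
    case (elim x)
    then have "(grad_norm X k d x)\<^sup>2 \<le> 1\<^sup>2" using grad_norm_nonneg by (intro power_mono)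
    then show ?case by (simp add: grad_norm_squared)
  qed
  moreover have "AE x in lborel. 1 / \<sigma>\<^sup>2 \<le> (\<Sum>i=1..k. (weak_deriv (X i) d x)\<^sup>2)"
    using d_grad_ge
  proof eventually_elim
    case (elim x)
    then have "(1 / \<sigma>)\<^sup>2 \<le> (grad_norm X k d x)\<^sup>2" using \<sigma> by (intro power_mono) auto
    then show ?case by (simp add: grad_norm_squared power_divide)
  qed
  moreover have "\<sigma> > 0" using \<sigma> by simp
  ultimately have shell: "f \<in> class_L X k \<Longrightarrow>
    (\<integral>\<^sup>+x. ennreal ((p\<^sup>2 * \<beta>\<^sup>2 / (4 * \<sigma>\<^sup>2) - \<delta>) * exp (- 6) * ((f x)\<^sup>2 * d x powr p) * exp (- \<beta> * d x powr p))
        * indicator {x. 1 \<le> d x \<and> d x \<le> T} x \<partial>lborel)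
    \<le> (\<integral>\<^sup>+x. ennreal ((2 * 3 powr (p - 2) * (bracket (d x) powr (2 - p) * (grad_norm X k f x)\<^sup>2)
        + (K + 32 * (1/2) powr (2 - p)) * (f x)\<^sup>2) * exp (- \<beta> * d x powr p)) \<partial>lborel)" for f T
    unfolding grad_norm_squared
    using d_balls d_laplacian[unfolded grad_norm_squared]
    by (intro weighted_estimate_on_shell[OF V class_L_weak_deriv[OF d_L] class_L_weak_deriv[of f X k]
          d_cont d_nonneg _ _ p _ K \<delta>(2)]) (auto simp: class_L_def)
  define c where "c = (p\<^sup>2 * \<beta>\<^sup>2 / (4 * \<sigma>\<^sup>2) - \<delta>) * exp (- 6)"
  define A where "A = 2 * 3 powr (p - 2)"
  define B where "B = K + 32 * (1/2) powr (2 - p)"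
  define E where "E x = exp (- \<beta> * d x powr p)" for x
  have pos: "c > 0" "A > 0" "B > 0" using \<delta> K by (simp_all add: c_def A_def B_def add_pos_pos)
  have E_pos: "E x > 0" for x by (simp add: E_def)
  have E_meas[measurable]: "E \<in> borel_measurable borel" unfolding E_def[abs_def] by measurable
  have \<mu>_eq: "(\<integral>\<^sup>+x. h x \<partial>\<mu>) = (\<integral>\<^sup>+x. ennreal (E x / Z) * h x \<partial>lborel)"
    if [measurable]: "h \<in> borel_measurable borel" for h
    unfolding \<mu>_def E_def by (rule nn_integral_density) measurable
  show ?thesis
  \<comment> \<open>\<open>c\<close> is the coefficient surviving on the shells, so \<open>A\<close>
    and \<open>B\<close> are divided by it. The added 1 comes from the region d < 1, which the
    shells miss.\<close>
  proof (rule exI[of _ "A / c"], rule exI[of _ "B / c + 1"], intro conjI ballI)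
    show "A / c > 0" "B / c + 1 > 0" using pos by (auto intro: add_pos_pos)
    fix f assume f: "f \<in> class_L X k"
    have [measurable]: "f \<in> borel_measurable borel"
      using f by (auto simp: class_L_def intro: borel_measurable_continuous_onI)
    have [measurable]: "(\<lambda>x. (grad_norm X k f x)\<^sup>2) \<in> borel_measurable borel"
      unfolding grad_norm_squared using is_weak_deriv_measurable[OF class_L_weak_deriv[OF f]] by measurable
    have [measurable]: "bracket \<in> borel_measurable borel"
      unfolding bracket_def[abs_def] by measurable
    define u where "u x = bracket (d x) powr (2 - p) * (grad_norm X k f x)\<^sup>2" for x
    have [measurable]: "u \<in> borel_measurable borel" unfolding u_def[abs_def] by measurable
    have u0: "u x \<ge> 0" for x by (simp add: u_def)
    define h where "h x = ennreal (c * ((f x)\<^sup>2 * d x powr p) * E x)" for x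
    have [measurable]: "h \<in> borel_measurable borel" unfolding h_def[abs_def] by measurable
    let ?R = "\<integral>\<^sup>+x. ennreal ((A * u x + B * (f x)\<^sup>2) * E x) \<partial>lborel"
    have "(\<integral>\<^sup>+x. h x * indicator {x. 1 \<le> d x} x \<partial>lborel)
        \<le> (\<integral>\<^sup>+x. (SUP n. h x * indicator {x. 1 \<le> d x \<and> d x \<le> real n} x) \<partial>lborel)"
    proof (rule nn_integral_mono)
      fix x
      obtain n where "d x \<le> real n" using real_arch_simple by blast
      then have "h x * indicator {x. 1 \<le> d x} x \<le> h x * indicator {x. 1 \<le> d x \<and> d x \<le> real n} x"
        by (simp split: split_indicator)
      then show "h x * indicator {x. 1 \<le> d x} x \<le> (SUP n. h x * indicator {x. 1 \<le> d x \<and> d x \<le> real n} x)"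
        by (rule SUP_upper2[OF UNIV_I])
    qed
    also have "\<dots> = (SUP n. \<integral>\<^sup>+x. h x * indicator {x. 1 \<le> d x \<and> d x \<le> real n} x \<partial>lborel)"
      by (intro nn_integral_monotone_convergence_SUP)
        (auto simp: incseq_def le_fun_def split: split_indicator)
    \<comment> \<open>The bound is uniform over the shells, so monotone convergence has removed the
      outer cutoff. It holds also when \<open>?R\<close> is infinite.\<close>
    also have "\<dots> \<le> ?R"
      unfolding h_def c_def A_def B_def E_def u_def by (intro SUP_least shell f)
    finally have outer: "(\<integral>\<^sup>+x. h x * indicator {x. 1 \<le> d x} x \<partial>lborel) \<le> ?R" .
    have "(\<integral>\<^sup>+x. ennreal ((f x)\<^sup>2 * d x powr p) \<partial>\<mu>)
        = (\<integral>\<^sup>+x. ennreal (E x / Z) * ennreal ((f x)\<^sup>2 * d x powr p) \<partial>lborel)"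
      by (intro \<mu>_eq) measurable
    also have "\<dots> \<le> (\<integral>\<^sup>+x. ennreal (E x / Z) * ennreal ((f x)\<^sup>2)
        + ennreal (1 / (c * Z)) * (h x * indicator {x. 1 \<le> d x} x) \<partial>lborel)"
    \<comment> \<open>The split is at d = 1: inside, d^p is at most 1; outside, the integrand is
      \<open>h\<close> up to the normalisation \<open>1 / (c * Z)\<close>.\<close>
    proof (rule nn_integral_mono)
      fix x
      show "ennreal (E x / Z) * ennreal ((f x)\<^sup>2 * d x powr p)
        \<le> ennreal (E x / Z) * ennreal ((f x)\<^sup>2) + ennreal (1 / (c * Z)) * (h x * indicator {x. 1 \<le> d x} x)"
      proof (cases "1 \<le> d x")
        case True
        have "ennreal (E x / Z) * ennreal ((f x)\<^sup>2 * d x powr p) = ennreal (1 / (c * Z)) * h x"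
          unfolding h_def using pos Z E_pos[of x]
          by (simp add: ennreal_mult[symmetric])
        then show ?thesis using True by simp
      next
        case False
        have "d x powr p \<le> 1 powr p" using False d_nonneg p by (intro powr_mono2) auto
        then have "(f x)\<^sup>2 * d x powr p \<le> (f x)\<^sup>2" by (simp add: mult_left_le)
        then show ?thesis using False by (simp add: mult_left_mono ennreal_leI)
      qed
    qed
    also have "\<dots> = (\<integral>\<^sup>+x. ennreal ((f x)\<^sup>2) \<partial>\<mu>)
        + ennreal (1 / (c * Z)) * (\<integral>\<^sup>+x. h x * indicator {x. 1 \<le> d x} x \<partial>lborel)"
      by (subst nn_integral_add) (auto simp: \<mu>_eq nn_integral_cmult)
    also have "\<dots> \<le> (\<integral>\<^sup>+x. ennreal ((f x)\<^sup>2) \<partial>\<mu>) + ennreal (1 / (c * Z)) * ?R"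
      by (intro add_left_mono mult_left_mono outer) auto
    also have "ennreal (1 / (c * Z)) * ?R
        = (\<integral>\<^sup>+x. ennreal (1 / (c * Z)) * ennreal ((A * u x + B * (f x)\<^sup>2) * E x) \<partial>lborel)"
      by (rule nn_integral_cmult[symmetric]) measurable
    also have "\<dots> = (\<integral>\<^sup>+x. ennreal (A / c) * (ennreal (E x / Z) * ennreal (u x))
        + ennreal (B / c) * (ennreal (E x / Z) * ennreal ((f x)\<^sup>2)) \<partial>lborel)"
    proof (rule nn_integral_cong)
      fix x
      have "1 / (c * Z) * ((A * u x + B * (f x)\<^sup>2) * E x)
        = A / c * (E x / Z * u x) + B / c * (E x / Z * (f x)\<^sup>2)"
        using pos Z by (simp add: field_simps)
      then show "ennreal (1 / (c * Z)) * ennreal ((A * u x + B * (f x)\<^sup>2) * E x)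
        = ennreal (A / c) * (ennreal (E x / Z) * ennreal (u x))
          + ennreal (B / c) * (ennreal (E x / Z) * ennreal ((f x)\<^sup>2))"
        using pos Z u0[of x] E_pos[of x]
        by (simp add: ennreal_mult[symmetric] ennreal_plus[symmetric] less_imp_le del: ennreal_plus)
    qed
    also have "\<dots> = ennreal (A / c) * (\<integral>\<^sup>+x. ennreal (u x) \<partial>\<mu>) + ennreal (B / c) * (\<integral>\<^sup>+x. ennreal ((f x)\<^sup>2) \<partial>\<mu>)"
      by (subst nn_integral_add) (auto simp: \<mu>_eq nn_integral_cmult)
    finally have "(\<integral>\<^sup>+x. ennreal ((f x)\<^sup>2 * d x powr p) \<partial>\<mu>)
      \<le> (\<integral>\<^sup>+x. ennreal ((f x)\<^sup>2) \<partial>\<mu>)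
        + (ennreal (A / c) * (\<integral>\<^sup>+x. ennreal (u x) \<partial>\<mu>) + ennreal (B / c) * (\<integral>\<^sup>+x. ennreal ((f x)\<^sup>2) \<partial>\<mu>))" .
    also have "\<dots> = ennreal (A / c) * (\<integral>\<^sup>+x. ennreal (u x) \<partial>\<mu>)
        + ennreal (B / c + 1) * (\<integral>\<^sup>+x. ennreal ((f x)\<^sup>2) \<partial>\<mu>)"
      using pos by (simp add: ennreal_plus distrib_right ac_simps)
    finally show "(\<integral>\<^sup>+x. ennreal ((f x)\<^sup>2 * d x powr p) \<partial>\<mu>)
      \<le> ennreal (A / c) * (\<integral>\<^sup>+x. ennreal (bracket (d x) powr (2 - p) * (grad_norm X k f x)\<^sup>2) \<partial>\<mu>)
        + ennreal (B / c + 1) * (\<integral>\<^sup>+x. ennreal ((f x)\<^sup>2) \<partial>\<mu>)"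
      unfolding u_def .
  qed
qed

end
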